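(* Let $S=\langle n_1,n_2,n_3,n_4\rangle$ be a 4-generated pseudo-symmetric numerical semigroup with parameters $\alpha_1,\alpha_2,\alpha_3,\alpha_4,\alpha_{21}$, where $\alpha_4=3$, $n_1<n_2<n_3<n_4$ and $\alpha_2>\alpha_{21}+1$. Let $s\ge 0$ and $l\ge 0$ be the smallest non-negative integers satisfying respectively $$s\alpha_1+(2s+2)\alpha_{21}+\alpha_3>(2s+1)\alpha_2+(s+2),\qquad l\alpha_1+(2l+3)\alpha_{21}+\alpha_3>(2l+2)\alpha_2+(l+1).$$ Then the numerator $P(I_S^* )$ of the Hilbert series of the local ring $R_S$ is $$\begin{aligned}P(I_S^* )={}&1-3t^3+3t^4-t^5-t^{\alpha_{21}+1}(1-t)(1+t-2t^2+t^3)-t^{\alpha_3}\bigl(1-t^{\alpha_{21}+1}-t^2(1-t^{\alpha_{21}})\bigr)\\&-t^{\alpha_2+2}(1-t)(1-t^{\alpha_{21}})(1-t^{\alpha_3-1})-t^{2\alpha_2+1}(1-t)(1-t^{\alpha_3-1})\\&-(1-t)^2(1-t^{2\alpha_2})R(t)-(1-t)^2(1-t^{\alpha_{21}})t^{(2s+1)\alpha_2+2}-(1-t)^2t^{(2l+2)\alpha_2+1},\end{aligned}$$ where $$R(t)=t^{2\alpha_{21}+\alpha_3}\sum_{j=0}^{s-1}t^{j(\alpha_1+2\alpha_{21}-1)}+t^{s\alpha_1+(2s+3)\alpha_{21}+\alpha_3-s}\sum_{j=0}^{l-s-1}t^{j(\alpha_1+2\alpha_{21}-1)}$$ for any $s>0$,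 and $R(t)=0$ if $s=0$ and $l=0$.
   Context: Parameters: a 4-generated numerical semigroup $S=\langle n_1,n_2,n_3,n_4\rangle$ ($\gcd(n_1,\dots,n_4)=1$) is pseudo-symmetric if and only if there are integers $\alpha_i>1$ ($1\le i\le 4$) and $\alpha_{21}$ with $0<\alpha_{21}<\alpha_1-1$ such that $n_1=\alpha_2\alpha_3(\alpha_4-1)+1$, $n_2=\alpha_{21}\alpha_3\alpha_4+(\alpha_1-\alpha_{21}-1)(\alpha_3-1)+\alpha_3$, $n_3=\alpha_1\alpha_4+(\alpha_1-\alpha_{21}-1)(\alpha_2-1)(\alpha_4-1)-\alpha_4+1$, $n_4=\alpha_1\alpha_2(\alpha_3-1)+\alpha_{21}(\alpha_2-1)+\alpha_2$. These integers are the parameters of $S$. Let $K$ be an algebraically closed field, $A=K[X_1,\dots,X_4]$, $I_S=\ker(A\to K[t],\ X_i\mapsto t^{n_i})$, and $R_S=K[[t^{n_1},\dots,t^{n_4}]]$ with maximal ideal $\mathfrak m=\langle t^{n_1},\dots,t^{n_4}\rangle$. For nonzero $f$, $f^*$ is the homogeneous summand of $f$ of least degree, and $I_S^*=\langle f^*: f\in I_S\rangle$, so that $\bigoplus_{i\ge0}\mathfrak m^i/\mathfrak m^{i+1}\cong A/I_S^*$. The Hilbert function of $R_S$ is $H_{R_S}(n)=\dim_{R_S/\mathfrak m}(\mathfrak m^n/\mathfrak m^{n+1})$, and its Hilbert series is $HS_{R_S}(t)=\sum_{n\ge0}H_{R_S}(n)t^n$. The numerator $P(I_S^* )$ (the first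 Hilbert series) is the polynomial with $HS_{R_S}(t)=P(I_S^* )/(1-t)^4$. Empty sums are zero. (It is known that $s\le l$.) *)

theory Defs
  imports
    "Jordan_Normal_Form.Missing_VectorSpace"
    "HOL-Algebra.Ideal_Product"
    "HOL-Algebra.QuotRing"
    "HOL-Computational_Algebra.Computational_Algebra"
begin

hide_const (open) Multiset.mult
hide_const (open) Polynomial.smult

definition semigroup4 :: "nat \<Rightarrow> nat \<Rightarrow> nat \<Rightarrow> nat \<Rightarrow> nat set" where
  "semigroup4 n1 n2 n3 n4 = {a1 * n1 + a2 * n2 + a3 * n3 + a4 * n4 | a1 a2 a3 a4. True}"

text \<open>\<open>F\<close> is the Frobenius number, the largest integer outside \<open>S\<close>; it is \<open>-1\<close>, hence odd, for
  \<open>S = \<nat>\<close>.  Pseudo-symmetry: \<open>F\<close> is even, and every integer \<open>x\<close> outside \<open>S\<close> other than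
  \<open>F / 2\<close> satisfies \<open>F - x \<in> S\<close>.\<close>

definition pseudo_symmetric :: "nat set \<Rightarrow> bool" where
  "pseudo_symmetric S \<longleftrightarrow>
    (\<exists>F::int. F \<notin> int ` S \<and> (\<forall>x>F. x \<in> int ` S) \<and> even F \<and>
       (\<forall>x. x \<notin> int ` S \<and> 2 * x \<noteq> F \<longrightarrow> F - x \<in> int ` S))"

text \<open>The equations are between integers, so no subtraction is truncated.\<close>

definition ps_parameters ::
  "nat \<Rightarrow> nat \<Rightarrow> nat \<Rightarrow> nat \<Rightarrow> nat \<Rightarrow> nat \<Rightarrow> nat \<Rightarrow> nat \<Rightarrow> nat \<Rightarrow> bool" where
  "ps_parameters n1 n2 n3 n4 \<alpha>1 \<alpha>2 \<alpha>3 \<alpha>4 \<alpha>21 \<longleftrightarrow>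
     \<alpha>1 > 1 \<and> \<alpha>2 > 1 \<and> \<alpha>3 > 1 \<and> \<alpha>4 > 1 \<and> 0 < \<alpha>21 \<and> int \<alpha>21 < int \<alpha>1 - 1 \<and>
     int n1 = int \<alpha>2 * int \<alpha>3 * (int \<alpha>4 - 1) + 1 \<and>
     int n2 = int \<alpha>21 * int \<alpha>3 * int \<alpha>4
              + (int \<alpha>1 - int \<alpha>21 - 1) * (int \<alpha>3 - 1) + int \<alpha>3 \<and>
     int n3 = int \<alpha>1 * int \<alpha>4
              + (int \<alpha>1 - int \<alpha>21 - 1) * (int \<alpha>2 - 1) * (int \<alpha>4 - 1) - int \<alpha>4 + 1 \<and>
     int n4 = int \<alpha>1 * int \<alpha>2 * (int \<alpha>3 - 1) + int \<alpha>21 * (int \<alpha>2 - 1) + int \<alpha>2"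

text \<open>\<open>K[[t^n1, t^n2, t^n3, t^n4]]\<close> as the image of \<open>K[[X1, X2, X3, X4]]\<close> in \<open>K[[t]]\<close> under
  \<open>Xi \<mapsto> t^ni\<close>: a power series with coefficients \<open>c a1 a2 a3 a4\<close> is sent to the series below.
  The index set of the sum is finite when all \<open>ni\<close> are positive.\<close>

definition semigroup_ring ::
  "nat \<Rightarrow> nat \<Rightarrow> nat \<Rightarrow> nat \<Rightarrow> 'k::field fps ring" where
  "semigroup_ring n1 n2 n3 n4 =
     \<lparr>carrier = {Abs_fps (\<lambda>k. \<Sum>(a1, a2, a3, a4) \<in>
                   {(a1, a2, a3, a4). a1 * n1 + a2 * n2 + a3 * n3 + a4 * n4 = k}. c a1 a2 a3 a4)
                 | c. True},
      mult = (*), one = 1, zero = 0, add = (+)\<rparr>"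

definition semigroup_ring_max ::
  "nat \<Rightarrow> nat \<Rightarrow> nat \<Rightarrow> nat \<Rightarrow> 'k::field fps set" where
  "semigroup_ring_max n1 n2 n3 n4 =
     genideal (semigroup_ring n1 n2 n3 n4) {fps_X ^ n1, fps_X ^ n2, fps_X ^ n3, fps_X ^ n4}"

abbreviation ideal_power :: "('a, 'b) ring_scheme \<Rightarrow> 'a set \<Rightarrow> nat \<Rightarrow> 'a set" where
  "ideal_power R I n \<equiv> I [^]\<^bsub>ideals_set R\<^esub> n"

text \<open>The \<open>R / I\<close>-module \<open>I^n / I^(n+1)\<close>: its elements are the cosets of \<open>I^(n+1)\<close> in \<open>I^n\<close>, and
  \<open>(a + I) (x + I^(n+1)) = a x + I^(n+1)\<close>.  The record type of modules extends that of rings;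
  its fields \<open>mult\<close> and \<open>one\<close> play no role for modules.\<close>

definition graded_piece ::
  "('a, 'b) ring_scheme \<Rightarrow> 'a set \<Rightarrow> nat \<Rightarrow> ('a set, 'a set) module" where
  "graded_piece R I n =
     \<lparr>carrier = {ideal_power R I (Suc n) +>\<^bsub>R\<^esub> x | x. x \<in> ideal_power R I n},
      mult = undefined, one = undefined,
      zero = ideal_power R I (Suc n), add = set_add R,
      smult = rcoset_mult R (ideal_power R I (Suc n))\<rparr>"

definition hilbert_function :: "('a, 'b) ring_scheme \<Rightarrow> 'a set \<Rightarrow> nat \<Rightarrow> nat" where
  "hilbert_function R I n = vectorspace.dim (R Quot I) (graded_piece R I n)"

definition hilbert_series :: "('a, 'b) ring_scheme \<Rightarrow> 'a set \<Rightarrow> rat fps" where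
  "hilbert_series R I = Abs_fps (\<lambda>n. of_nat (hilbert_function R I n))"

text \<open>The correction term \<open>R(t)\<close>; it vanishes for \<open>s = l = 0\<close>, both sums being empty,
  and the same formula covers \<open>s = 0 < l\<close>.  Since \<open>\<alpha>1 \<ge> 1\<close> and \<open>s \<le> l\<close> in all uses, the subtractions are not truncated.\<close>

definition R_term :: "nat \<Rightarrow> nat \<Rightarrow> nat \<Rightarrow> nat \<Rightarrow> nat \<Rightarrow> rat poly \<Rightarrow> rat poly" where
  "R_term \<alpha>1 \<alpha>3 \<alpha>21 s l t =
     t ^ (2 * \<alpha>21 + \<alpha>3) * (\<Sum>j<s. t ^ (j * (\<alpha>1 + 2 * \<alpha>21 - 1)))
     + t ^ (s * \<alpha>1 + (2 * s + 3) * \<alpha>21 + \<alpha>3 - s)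
       * (\<Sum>j<l - s. t ^ (j * (\<alpha>1 + 2 * \<alpha>21 - 1)))"

end

theory Submission imports Defs
begin

text \<open>
  The power \<open>\<mm>\<^sup>n\<close> consists of the series supported on those elements of the semigroup that have a
  factorization into at least \<open>n\<close> generators.  Hence \<open>H(n)\<close> counts the elements whose longest
  factorization has length \<open>n\<close>.  The binomials of the ideal \<open>I_S\<close>, read as rewriting rules that
  never shorten a factorization, bring every element into a normal form of maximal length:
  with \<open>\<alpha>1, \<alpha>2, \<alpha>3, \<alpha>21\<close> written \<open>a, b, c, d\<close>, the rules replace \<open>X3 X4^2\<close>, \<open>X1^d X4\<close>, \<open>X3^c\<close>,
  \<open>X4^3\<close>, \<open>X2 X4^2\<close>, \<open>X2^b X3 X4\<close>, \<open>X2^(2b) X3\<close>, \<open>X2^((2s+1)b+1) X4\<close>, \<open>X2^((2l+2)b+1)\<close> and the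
  products of a power of \<open>X1\<close> with \<open>X3^(c-1-J)\<close> for \<open>J < l\<close>.  Normal forms are unique because the
  lattice of relations is \<open>{(i, j, k, m). j - 2bk + bm = q n1, i + (a + 2d)k - dm = - q n2}\<close>, and
  the values of \<open>j - 2bk + bm\<close> on normal forms differ by less than \<open>2 n1\<close>.  The normal forms fall into
  boxes, whose generating functions add up to the stated rational function.
\<close>

section \<open>The graded pieces of an ideal\<close>

lemma (in cring) ideal_power_0: "ideal_power R I 0 = carrier R"
  by (simp add: ideals_set_def)

lemma (in cring) ideal_power_Suc: "ideal_power R I (Suc n) = ideal_prod R (ideal_power R I n) I"
  by (simp add: ideals_set_def)

lemma (in cring) ideal_ideal_power:
  assumes "ideal I R"
  shows "ideal (ideal_power R I n) R"
proof (induction n)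
  case 0
  show ?case by (simp only: ideal_power_0 oneideal)
next
  case (Suc n)
  then show ?case by (simp only: ideal_power_Suc ideal_prod_is_ideal assms)
qed

text \<open>\<open>rcoset_mult\<close> is a union over all pairs of representatives. It collapses to
  a single coset because each product differs from \<open>r x\<close> by
  \<open>i j + i x + r j\<close>, and all three terms lie in \<open>I^(n+1)\<close>.\<close>

lemma (in cring) graded_piece_smult:
  assumes I: "ideal I R" and r: "r \<in> carrier R" and x: "x \<in> ideal_power R I n"
  shows "(I +> r) \<odot>\<^bsub>graded_piece R I n\<^esub> (ideal_power R I (Suc n) +> x)
    = ideal_power R I (Suc n) +> (r \<otimes> x)"
proof -
  let ?P = "ideal_power R I n" and ?J = "ideal_power R I (Suc n)"
  interpret I: ideal I R by fact
  interpret P: ideal ?P R by (rule ideal_ideal_power [OF I])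
  interpret J: ideal ?J R by (rule ideal_ideal_power [OF I])
  have IP: "i \<otimes> p \<in> ?J" if "i \<in> I" "p \<in> ?P" for i p
    using ideal_prod.prod [OF that(2,1), of R] that
    by (simp add: ideal_power_Suc m_comm del: Group.nat_pow_Suc)
  have JP: "j \<in> ?P" if "j \<in> ?J" for j
    using that ideal_prod_inter [OF P.ideal_axioms I] by (auto simp: ideal_power_Suc simp del: Group.nat_pow_Suc)
  have *: "?J +> (r' \<otimes> x') = ?J +> (r \<otimes> x)" if r': "r' \<in> I +> r" and x': "x' \<in> ?J +> x" for r' x'
  proof -
    from r' x' obtain i j where i: "i \<in> I" "r' = i \<oplus> r" and j: "j \<in> ?J" "x' = j \<oplus> x"
      by (auto simp: a_r_coset_def')
    have carr: "i \<in> carrier R" "j \<in> carrier R" "x \<in> carrier R"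
      using i j x by (auto simp: I.Icarr J.Icarr P.Icarr)
    have "r' \<otimes> x' = (i \<otimes> j \<oplus> i \<otimes> x \<oplus> r \<otimes> j) \<oplus> r \<otimes> x"
      unfolding i(2) j(2) using carr r by algebra
    moreover have "i \<otimes> j \<oplus> i \<otimes> x \<oplus> r \<otimes> j \<in> ?J"
      by (intro J.a_closed IP J.I_l_closed i j x r JP)
    ultimately have "r' \<otimes> x' \<in> ?J +> (r \<otimes> x)"
      by (auto simp: a_r_coset_def' simp del: Group.nat_pow_Suc)
    then show ?thesis
      using carr r by (intro a_repr_independence [symmetric] J.a_subgroup) auto
  qed
  have self: "r \<in> I +> r" "x \<in> ?J +> x"
    using I.a_rcos_self J.a_rcos_self r x P.Icarr by blast+
  have "rcoset_mult R ?J (I +> r) (?J +> x) = (\<Union>r'\<in>I +> r. \<Union>x'\<in>?J +> x. ?J +> (r \<otimes> x))"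
    unfolding rcoset_mult_def by (intro SUP_cong refl) (use * in blast)
  also have "\<dots> = ?J +> (r \<otimes> x)" using self by blast
  finally show ?thesis by (simp add: graded_piece_def del: Group.nat_pow_Suc)
qed

text \<open>Needed to treat a graded piece as a vector space when \<open>I\<close> is maximal, so
  that \<open>hilbert_function\<close> can be read off from a basis. Every axiom is inherited from
  the ring through representatives.\<close>

lemma (in cring) graded_piece_module:
  assumes I: "ideal I R"
  shows "Module.module (R Quot I) (graded_piece R I n)"
proof -
  let ?P = "ideal_power R I n" and ?J = "ideal_power R I (Suc n)" and ?G = "graded_piece R I n"
  interpret I: ideal I R by fact
  interpret P: ideal ?P R by (rule ideal_ideal_power [OF I])
  interpret J: ideal ?J R by (rule ideal_ideal_power [OF I])
  have carrG: "carrier ?G = {?J +> x | x. x \<in> ?P}" and zeroG: "\<zero>\<^bsub>?G\<^esub> = ?J"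
    by (simp_all add: graded_piece_def)
  have addG: "(?J +> x) \<oplus>\<^bsub>?G\<^esub> (?J +> y) = ?J +> (x \<oplus> y)" if "x \<in> ?P" "y \<in> ?P" for x y
    using that by (simp add: graded_piece_def J.a_rcos_sum P.Icarr del: Group.nat_pow_Suc)
  have zero': "?J = ?J +> \<zero>" by (simp add: J.a_subset del: Group.nat_pow_Suc)
  have carrQ: "carrier (R Quot I) = {I +> r | r. r \<in> carrier R}"
    by (auto simp: FactRing_def A_RCOSETS_def')
  have addQ: "(I +> r) \<oplus>\<^bsub>R Quot I\<^esub> (I +> q) = I +> (r \<oplus> q)"
    and multQ: "(I +> r) \<otimes>\<^bsub>R Quot I\<^esub> (I +> q) = I +> (r \<otimes> q)"
    if "r \<in> carrier R" "q \<in> carrier R" for r q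
    using that by (simp_all add: FactRing_def I.a_rcos_sum I.rcoset_mult_add)
  have oneQ: "\<one>\<^bsub>R Quot I\<^esub> = I +> \<one>" by (simp add: FactRing_def)
  note smultG = graded_piece_smult [OF I]
  note [simp del] = Group.nat_pow_Suc
  note [simp] = addG addQ multQ oneQ smultG P.Icarr
  show ?thesis
  proof (rule module_criteria)
    show "cring (R Quot I)" by (rule I.quotient_is_cring) (rule is_cring)
    show "\<zero>\<^bsub>?G\<^esub> \<in> carrier ?G" using zero' zeroG carrG P.zero_closed by blast
    show "\<forall>v w. v \<in> carrier ?G \<and> w \<in> carrier ?G \<longrightarrow> v \<oplus>\<^bsub>?G\<^esub> w \<in> carrier ?G"
      unfolding carrG using P.a_closed addG by blast
    show "\<forall>v\<in>carrier ?G. \<exists>neg_v\<in>carrier ?G. v \<oplus>\<^bsub>?G\<^esub> neg_v = \<zero>\<^bsub>?G\<^esub>"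
    proof
      fix v assume "v \<in> carrier ?G"
      then obtain x where x: "x \<in> ?P" "v = ?J +> x" by (auto simp: carrG)
      then have "v \<oplus>\<^bsub>?G\<^esub> (?J +> (\<ominus> x)) = \<zero>\<^bsub>?G\<^esub>"
        by (simp add: r_neg zeroG zero'[symmetric])
      then show "\<exists>neg_v\<in>carrier ?G. v \<oplus>\<^bsub>?G\<^esub> neg_v = \<zero>\<^bsub>?G\<^esub>"
        using x P.a_inv_closed unfolding carrG by blast
    qed
    show "\<forall>c v. c \<in> carrier (R Quot I) \<and> v \<in> carrier ?G \<longrightarrow> c \<odot>\<^bsub>?G\<^esub> v \<in> carrier ?G"
      unfolding carrG carrQ using P.I_l_closed smultG by blast
    show "\<forall>v w. v \<in> carrier ?G \<and> w \<in> carrier ?G \<longrightarrow> v \<oplus>\<^bsub>?G\<^esub> w = w \<oplus>\<^bsub>?G\<^esub> v"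
      by (auto simp: carrG a_comm)
    show "\<forall>v w x. v \<in> carrier ?G \<and> w \<in> carrier ?G \<and> x \<in> carrier ?G
        \<longrightarrow> v \<oplus>\<^bsub>?G\<^esub> w \<oplus>\<^bsub>?G\<^esub> x = v \<oplus>\<^bsub>?G\<^esub> (w \<oplus>\<^bsub>?G\<^esub> x)"
      by (auto simp: carrG a_assoc)
    show "\<forall>v\<in>carrier ?G. v \<oplus>\<^bsub>?G\<^esub> \<zero>\<^bsub>?G\<^esub> = v"
    proof
      fix v assume "v \<in> carrier ?G"
      then obtain x where x: "x \<in> ?P" "v = ?J +> x" by (auto simp: carrG)
      then show "v \<oplus>\<^bsub>?G\<^esub> \<zero>\<^bsub>?G\<^esub> = v"
        using addG [OF x(1) P.zero_closed] by (simp add: zeroG zero'[symmetric])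
    qed
    show "\<forall>a b v. a \<in> carrier (R Quot I) \<and> b \<in> carrier (R Quot I) \<and> v \<in> carrier ?G
        \<longrightarrow> (a \<otimes>\<^bsub>R Quot I\<^esub> b) \<odot>\<^bsub>?G\<^esub> v = a \<odot>\<^bsub>?G\<^esub> (b \<odot>\<^bsub>?G\<^esub> v)"
      by (auto simp: carrG carrQ m_assoc P.I_l_closed)
    show "\<forall>v\<in>carrier ?G. \<one>\<^bsub>R Quot I\<^esub> \<odot>\<^bsub>?G\<^esub> v = v"
      by (auto simp: carrG)
    show "\<forall>a b v. a \<in> carrier (R Quot I) \<and> b \<in> carrier (R Quot I) \<and> v \<in> carrier ?G
        \<longrightarrow> (a \<oplus>\<^bsub>R Quot I\<^esub> b) \<odot>\<^bsub>?G\<^esub> v = a \<odot>\<^bsub>?G\<^esub> v \<oplus>\<^bsub>?G\<^esub> b \<odot>\<^bsub>?G\<^esub> v"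
      by (auto simp: carrG carrQ l_distr P.I_l_closed)
    show "\<forall>a v w. a \<in> carrier (R Quot I) \<and> v \<in> carrier ?G \<and> w \<in> carrier ?G
        \<longrightarrow> a \<odot>\<^bsub>?G\<^esub> (v \<oplus>\<^bsub>?G\<^esub> w) = a \<odot>\<^bsub>?G\<^esub> v \<oplus>\<^bsub>?G\<^esub> a \<odot>\<^bsub>?G\<^esub> w"
      by (auto simp: carrG carrQ r_distr P.I_l_closed)
  qed
qed

section \<open>Powers of the maximal ideal\<close>

locale numerical_generators =
  fixes n1 n2 n3 n4 :: nat
  assumes pos: "0 < n1" "0 < n2" "0 < n3" "0 < n4"
begin

section \<open>Semigroup elements graded by factorization length\<close>

definition val :: "nat \<Rightarrow> nat \<Rightarrow> nat \<Rightarrow> nat \<Rightarrow> nat" where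
  "val a1 a2 a3 a4 = a1 * n1 + a2 * n2 + a3 * n3 + a4 * n4"

definition order_ge :: "nat \<Rightarrow> nat set" where
  "order_ge n = {val a1 a2 a3 a4 | a1 a2 a3 a4. n \<le> a1 + a2 + a3 + a4}"

text \<open>An explicit model of the powers of the maximal ideal;
  \<open>ideal_power_series_ge\<close> confirms it. The case \<open>n = 0\<close> is the whole
  ring.\<close>

definition series_ge :: "nat \<Rightarrow> 'k::field fps set" where
  "series_ge n = {f. \<forall>k. fps_nth f k \<noteq> 0 \<longrightarrow> k \<in> order_ge n}"

lemma degree_le_val: "a1 + a2 + a3 + a4 \<le> val a1 a2 a3 a4"
proof -
  have "a1 * 1 + a2 * 1 + a3 * 1 + a4 * 1 \<le> val a1 a2 a3 a4"
    unfolding val_def by (intro add_mono mult_left_mono) (use pos in auto)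
  then show ?thesis by simp
qed

lemma val_le: "val a1 a2 a3 a4 \<le> (a1 + a2 + a3 + a4) * (n1 + n2 + n3 + n4)"
  by (simp add: val_def algebra_simps)

lemma order_geI: "n \<le> a1 + a2 + a3 + a4 \<Longrightarrow> x = val a1 a2 a3 a4 \<Longrightarrow> x \<in> order_ge n"
  by (auto simp: order_ge_def)

lemma order_ge_antimono: "m \<le> n \<Longrightarrow> order_ge n \<subseteq> order_ge m"
  by (force simp: order_ge_def)

lemma order_ge_add:
  assumes "x \<in> order_ge m" "y \<in> order_ge n"
  shows "x + y \<in> order_ge (m + n)"
proof -
  obtain a1 a2 a3 a4 where a: "x = val a1 a2 a3 a4" "m \<le> a1 + a2 + a3 + a4"
    using assms by (auto simp: order_ge_def)
  obtain b1 b2 b3 b4 where b: "y = val b1 b2 b3 b4" "n \<le> b1 + b2 + b3 + b4"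
    using assms by (auto simp: order_ge_def)
  show ?thesis
    by (rule order_geI [of _ "a1 + b1" "a2 + b2" "a3 + b3" "a4 + b4"])
       (use a b in \<open>auto simp: val_def algebra_simps\<close>)
qed

lemma zero_in_order_ge_0: "0 \<in> order_ge 0"
  by (rule order_geI [of _ 0 0 0 0]) (auto simp: val_def)

lemma order_ge_le: "x \<in> order_ge n \<Longrightarrow> n \<le> x"
  using degree_le_val order_trans by (fastforce simp: order_ge_def)

lemma in_order_ge_1: "x \<in> order_ge 0 \<Longrightarrow> x \<noteq> 0 \<Longrightarrow> x \<in> order_ge 1"
  by (force simp: order_ge_def val_def)

lemma generator_in_order_ge: "{n1, n2, n3, n4} \<subseteq> order_ge 1"
  using order_geI [of 1 1 0 0 0] order_geI [of 1 0 1 0 0] order_geI [of 1 0 0 1 0]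
    order_geI [of 1 0 0 0 1] by (auto simp: val_def)

lemma order_ge_SucE:
  assumes "x \<in> order_ge (Suc n)"
  obtains g y where "g \<in> {n1, n2, n3, n4}" "y \<in> order_ge n" "x = g + y"
proof -
  obtain a1 a2 a3 a4 where a: "x = val a1 a2 a3 a4" "Suc n \<le> a1 + a2 + a3 + a4"
    using assms by (auto simp: order_ge_def)
  then consider "a1 > 0" | "a2 > 0" | "a3 > 0" | "a4 > 0" by linarith
  then show ?thesis
  proof cases
    case 1
    then show ?thesis using a
      by (intro that [of n1 "val (a1 - 1) a2 a3 a4"] order_geI [OF _ refl])
         (auto simp: val_def algebra_simps gr0_conv_Suc)
  next
    case 2
    then show ?thesis using a
      by (intro that [of n2 "val a1 (a2 - 1) a3 a4"] order_geI [OF _ refl])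
         (auto simp: val_def algebra_simps gr0_conv_Suc)
  next
    case 3
    then show ?thesis using a
      by (intro that [of n3 "val a1 a2 (a3 - 1) a4"] order_geI [OF _ refl])
         (auto simp: val_def algebra_simps gr0_conv_Suc)
  next
    case 4
    then show ?thesis using a
      by (intro that [of n4 "val a1 a2 a3 (a4 - 1)"] order_geI [OF _ refl])
         (auto simp: val_def algebra_simps gr0_conv_Suc)
  qed
qed

text \<open>No factorization of such an element is longer than \<open>n\<close>, so its value is at
  most \<open>n\<close> times the sum of the generators.\<close>

lemma finite_order_eq: "finite (order_ge n - order_ge (Suc n))"
proof (rule finite_subset)
  show "order_ge n - order_ge (Suc n) \<subseteq> {..n * (n1 + n2 + n3 + n4)}"
  proof
    fix x assume x: "x \<in> order_ge n - order_ge (Suc n)"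
    then obtain a1 a2 a3 a4 where a: "x = val a1 a2 a3 a4" by (auto simp: order_ge_def)
    then have "a1 + a2 + a3 + a4 \<le> n" using x order_geI [of "Suc n" a1 a2 a3 a4 x] by force
    then show "x \<in> {..n * (n1 + n2 + n3 + n4)}"
      using val_le [of a1 a2 a3 a4] mult_le_mono1 order_trans unfolding a by blast
  qed
qed simp

section \<open>Power series with support in \<open>order_ge n\<close>\<close>

lemma series_ge_antimono: "m \<le> n \<Longrightarrow> series_ge n \<subseteq> series_ge m"
  using order_ge_antimono by (force simp: series_ge_def)

lemma series_ge_0 [simp]: "0 \<in> series_ge n"
  by (simp add: series_ge_def)

lemma series_ge_add: "f \<in> series_ge n \<Longrightarrow> g \<in> series_ge n \<Longrightarrow> f + g \<in> series_ge n"
  unfolding series_ge_def by (auto, metis add.right_neutral)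

lemma series_ge_uminus: "f \<in> series_ge n \<Longrightarrow> - f \<in> series_ge n"
  by (simp add: series_ge_def)

lemma series_ge_sum: "(\<And>x. x \<in> A \<Longrightarrow> f x \<in> series_ge n) \<Longrightarrow> sum f A \<in> series_ge n"
  by (induction A rule: infinite_finite_induct) (auto intro: series_ge_add)

lemma series_ge_mult:
  assumes "f \<in> series_ge m" "g \<in> series_ge n"
  shows "f * g \<in> series_ge (m + n)"
proof -
  have "k \<in> order_ge (m + n)" if "fps_nth (f * g) k \<noteq> 0" for k
  proof -
    from that have "(\<Sum>i=0..k. fps_nth f i * fps_nth g (k - i)) \<noteq> 0" by (simp add: fps_mult_nth)
    then obtain i where i: "i \<in> {0..k}" "fps_nth f i * fps_nth g (k - i) \<noteq> 0"
      by (meson sum.neutral)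
    then have "i + (k - i) \<in> order_ge (m + n)"
      using assms by (intro order_ge_add) (auto simp: series_ge_def)
    then show ?thesis using i by simp
  qed
  then show ?thesis by (simp add: series_ge_def)
qed

lemma X_power_in_series_ge: "x \<in> order_ge n \<Longrightarrow> fps_X ^ x \<in> series_ge n"
  by (simp add: series_ge_def fps_X_power_nth)

lemma const_in_series_ge_0: "fps_const c \<in> series_ge 0"
  using zero_in_order_ge_0 by (simp add: series_ge_def)

text \<open>Each exponent in the support has a generator that can be split off. Choosing one per
  exponent and grouping the terms by this choice gives a finite combination, although the series may
  be infinite.\<close>

lemma series_ge_SucE:
  assumes f: "f \<in> series_ge (Suc n)"
  obtains h where "\<And>g. h g \<in> series_ge n" "f = (\<Sum>g\<in>{n1, n2, n3, n4}. h g * fps_X ^ g)"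
proof -
  have "\<exists>g. fps_nth f k \<noteq> 0 \<longrightarrow> g \<in> {n1, n2, n3, n4} \<and> g \<le> k \<and> k - g \<in> order_ge n" for k
  proof (cases "fps_nth f k = 0")
    case False
    then have "k \<in> order_ge (Suc n)" using f by (simp add: series_ge_def)
    then obtain g y where "g \<in> {n1, n2, n3, n4}" "y \<in> order_ge n" "k = g + y"
      by (rule order_ge_SucE)
    then show ?thesis by (intro exI [of _ g]) simp
  qed simp
  then obtain G where G: "fps_nth f k \<noteq> 0 \<Longrightarrow>
      G k \<in> {n1, n2, n3, n4} \<and> G k \<le> k \<and> k - G k \<in> order_ge n" for k
    by metis
  \<comment> \<open>The terms of \<open>f\<close> whose exponent was assigned to the generator
    \<open>g\<close>, shifted down by \<open>g\<close>.\<close>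
  define h where "h g = Abs_fps (\<lambda>j. if G (j + g) = g then fps_nth f (j + g) else 0)" for g
  have "h g \<in> series_ge n" for g
    using G by (auto simp: series_ge_def h_def) (metis add_diff_cancel_right')
  moreover have "f = (\<Sum>g\<in>{n1, n2, n3, n4}. h g * fps_X ^ g)"
  proof (rule fps_ext)
    fix k
    have "fps_nth (\<Sum>g\<in>{n1, n2, n3, n4}. h g * fps_X ^ g) k
        = (\<Sum>g\<in>{n1, n2, n3, n4}. if G k = g \<and> g \<le> k then fps_nth f k else 0)"
      by (auto simp: fps_sum_nth fps_X_power_mult_right_nth h_def intro!: sum.cong)
    also have "\<dots> = (\<Sum>g\<in>{n1, n2, n3, n4}. if G k = g then fps_nth f k else 0)"
      using G [of k] by (intro sum.cong) auto
    also have "\<dots> = fps_nth f k"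
      using G [of k] by (subst sum.delta') auto
    finally show "fps_nth f k = fps_nth (\<Sum>g\<in>{n1, n2, n3, n4}. h g * fps_X ^ g) k" ..
  qed
  ultimately show ?thesis by (rule that)
qed

section \<open>The local ring, its maximal ideal and its graded pieces\<close>

abbreviation RS :: "'k::field fps ring" where
  "RS \<equiv> semigroup_ring n1 n2 n3 n4"

lemma finite_factorizations:
  "finite {(a1, a2, a3, a4). a1 * n1 + a2 * n2 + a3 * n3 + a4 * n4 = k}"
proof (rule finite_subset)
  show "{(a1, a2, a3, a4). a1 * n1 + a2 * n2 + a3 * n3 + a4 * n4 = k}
      \<subseteq> {..k} \<times> {..k} \<times> {..k} \<times> {..k}"
  proof clarsimp
    fix a1 a2 a3 a4
    show "a1 \<le> a1 * n1 + a2 * n2 + a3 * n3 + a4 * n4 \<and> a2 \<le> a1 * n1 + a2 * n2 + a3 * n3 + a4 * n4 \<and>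
        a3 \<le> a1 * n1 + a2 * n2 + a3 * n3 + a4 * n4 \<and> a4 \<le> a1 * n1 + a2 * n2 + a3 * n3 + a4 * n4"
      using degree_le_val [of a1 a2 a3 a4] by (simp add: val_def)
  qed
qed simp

lemma carrier_RS: "carrier (RS :: 'k::field fps ring) = series_ge 0"
proof (intro equalityI subsetI)
  fix f :: "'k fps" assume "f \<in> carrier RS"
  then obtain c where c: "f = Abs_fps (\<lambda>k. \<Sum>(a1, a2, a3, a4) \<in>
      {(a1, a2, a3, a4). a1 * n1 + a2 * n2 + a3 * n3 + a4 * n4 = k}. c a1 a2 a3 a4)"
    unfolding semigroup_ring_def by auto
  have "k \<in> order_ge 0" if "fps_nth f k \<noteq> 0" for k
  proof -
    have "{(a1, a2, a3, a4). a1 * n1 + a2 * n2 + a3 * n3 + a4 * n4 = k} \<noteq> {}"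
      using that unfolding c by (metis (no_types, lifting) fps_nth_Abs_fps sum.empty)
    then show ?thesis by (auto simp: order_ge_def val_def)
  qed
  then show "f \<in> series_ge 0" by (simp add: series_ge_def)
next
  fix f :: "'k fps" assume f: "f \<in> series_ge 0"
  define A where "A k = {(a1, a2, a3, a4). a1 * n1 + a2 * n2 + a3 * n3 + a4 * n4 = k}" for k
  \<comment> \<open>One factorization of \<open>k\<close> is selected and carries the whole
    coefficient of \<open>t^k\<close>, so the sum over all factorizations of \<open>k\<close> has
    one possibly nonzero term. If \<open>k\<close> has no factorization, that coefficient of
    \<open>f\<close> is already zero.\<close>
  define r where "r k = (SOME p. p \<in> A k)" for k
  define c where "c a1 a2 a3 a4 = (let k = val a1 a2 a3 a4 in
      if r k = (a1, a2, a3, a4) then fps_nth f k else 0)" for a1 a2 a3 a4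
  have "(\<Sum>(a1, a2, a3, a4) \<in> A k. c a1 a2 a3 a4) = fps_nth f k" for k
  proof -
    have "(\<Sum>(a1, a2, a3, a4) \<in> A k. c a1 a2 a3 a4) = (\<Sum>p\<in>A k. if r k = p then fps_nth f k else 0)"
      by (intro sum.cong) (auto simp: A_def c_def val_def)
    also have "\<dots> = (if r k \<in> A k then fps_nth f k else 0)"
      by (rule sum.delta') (simp add: A_def finite_factorizations)
    also have "\<dots> = fps_nth f k"
    proof (cases "fps_nth f k = 0")
      case False
      then obtain a1 a2 a3 a4 where "k = val a1 a2 a3 a4"
        using f by (auto simp: series_ge_def order_ge_def)
      then have "(a1, a2, a3, a4) \<in> A k" by (simp add: A_def val_def)
      then have "\<exists>p. p \<in> A k" ..
      then have "r k \<in> A k" unfolding r_def by (rule someI_ex)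
      then show ?thesis by simp
    qed simp
    finally show ?thesis .
  qed
  then have "f = Abs_fps (\<lambda>k. \<Sum>(a1, a2, a3, a4) \<in> A k. c a1 a2 a3 a4)"
    by (simp add: fps_eq_iff)
  then show "f \<in> carrier RS" unfolding semigroup_ring_def A_def by auto
qed

lemma RS_simps [simp]:
  "mult RS = (*)" "one RS = 1" "zero RS = 0" "add RS = (+)"
  by (simp_all add: semigroup_ring_def)

lemma one_in_series_ge_0: "1 \<in> series_ge 0"
  using const_in_series_ge_0 [of 1] by simp

lemma cring_RS: "cring (RS :: 'k::field fps ring)"
proof (rule cringI)
  show "abelian_group (RS :: 'k fps ring)"
  proof (rule abelian_groupI)
    fix x :: "'k fps" assume "x \<in> carrier RS"
    then show "\<exists>y\<in>carrier RS. y \<oplus>\<^bsub>RS\<^esub> x = \<zero>\<^bsub>RS\<^esub>"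
      by (intro bexI [of _ "- x"]) (auto simp: carrier_RS series_ge_uminus)
  qed (auto simp: carrier_RS algebra_simps intro: series_ge_add)
  show "comm_monoid (RS :: 'k fps ring)"
    using series_ge_mult [of _ 0 _ 0]
    by (intro comm_monoidI) (auto simp: carrier_RS algebra_simps one_in_series_ge_0)
qed (auto simp: algebra_simps)

lemma ideal_series_ge: "ideal (series_ge n) (RS :: 'k::field fps ring)"
proof -
  interpret cring "RS :: 'k fps ring" by (rule cring_RS)
  have inv: "inv\<^bsub>add_monoid RS\<^esub> x = - x" if "x \<in> carrier RS" for x :: "'k fps"
    using that series_ge_uminus [of x 0]
    by (intro comm_monoid.comm_inv_char [OF add.comm_monoid_axioms]) (auto simp: carrier_RS)
  show ?thesis
  proof (rule idealI [OF ring_axioms])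
    show "subgroup (series_ge n) (add_monoid (RS :: 'k fps ring))"
    proof
      show "series_ge n \<subseteq> carrier (add_monoid (RS :: 'k fps ring))"
        by (simp add: carrier_RS series_ge_antimono)
      then show "x \<in> series_ge n \<Longrightarrow> inv\<^bsub>add_monoid RS\<^esub> x \<in> series_ge n" for x :: "'k fps"
        using inv [of x] series_ge_uminus [of x n] by (simp add: subset_eq)
    qed (auto intro: series_ge_add)
    fix a x :: "'k fps" assume "a \<in> series_ge n" "x \<in> carrier RS"
    then show "x \<otimes>\<^bsub>RS\<^esub> a \<in> series_ge n" "a \<otimes>\<^bsub>RS\<^esub> x \<in> series_ge n"
      using series_ge_mult [of x 0 a n] by (auto simp: carrier_RS mult.commute)
  qed
qed

lemma sum_in_ideal:
  assumes "ideal J (RS :: 'k::field fps ring)" "\<And>x. x \<in> A \<Longrightarrow> f x \<in> J"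
  shows "sum f A \<in> J"
proof -
  interpret ideal J "RS :: 'k fps ring" by fact
  show ?thesis
    using assms(2) additive_subgroup.zero_closed [OF is_additive_subgroup]
      additive_subgroup.a_closed [OF is_additive_subgroup]
    by (induction A rule: infinite_finite_induct) auto
qed

lemma semigroup_ring_max_eq: "semigroup_ring_max n1 n2 n3 n4 = (series_ge 1 :: 'k::field fps set)"
proof
  interpret cring "RS :: 'k fps ring" by (rule cring_RS)
  let ?G = "{fps_X ^ n1, fps_X ^ n2, fps_X ^ n3, fps_X ^ n4} :: 'k fps set"
  have G: "?G \<subseteq> series_ge 1"
    using generator_in_order_ge by (auto intro: X_power_in_series_ge)
  then have GR: "?G \<subseteq> carrier RS"
    using series_ge_antimono [of 0 1] by (auto simp: carrier_RS)
  show "semigroup_ring_max n1 n2 n3 n4 \<subseteq> (series_ge 1 :: 'k fps set)"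
    unfolding semigroup_ring_max_def by (rule genideal_minimal [OF ideal_series_ge G])
  interpret I: ideal "genideal RS ?G" "RS :: 'k fps ring" by (rule genideal_ideal [OF GR])
  show "series_ge 1 \<subseteq> (semigroup_ring_max n1 n2 n3 n4 :: 'k fps set)"
  proof
    fix f :: "'k fps" assume "f \<in> series_ge 1"
    then obtain h where h: "\<And>g. h g \<in> series_ge 0" "f = (\<Sum>g\<in>{n1, n2, n3, n4}. h g * fps_X ^ g)"
      using series_ge_SucE [of f 0] by auto
    have "h g * fps_X ^ g \<in> genideal RS ?G" if "g \<in> {n1, n2, n3, n4}" for g
      using I.I_l_closed [of "fps_X ^ g" "h g"] genideal_self [OF GR] that h by (auto simp: carrier_RS)
    then show "f \<in> semigroup_ring_max n1 n2 n3 n4"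
      unfolding h(2) semigroup_ring_max_def by (intro sum_in_ideal [OF I.ideal_axioms])
  qed
qed

text \<open>Lengths of factorizations add under products, which gives one inclusion;
  \<open>series_ge_SucE\<close> writes every series of the larger order as a combination of products
  and gives the other.\<close>

lemma ideal_power_series_ge: "ideal_power RS (series_ge 1) n = (series_ge n :: 'k::field fps set)"
proof (induction n)
  interpret cring "RS :: 'k fps ring" by (rule cring_RS)
  case 0
  show ?case by (simp only: ideal_power_0 carrier_RS)
next
  interpret cring "RS :: 'k fps ring" by (rule cring_RS)
  case (Suc n)
  have "ideal_prod RS (series_ge n) (series_ge 1) = (series_ge (Suc n) :: 'k fps set)"
  proof (intro equalityI subsetI)
    fix f :: "'k fps" assume "f \<in> ideal_prod RS (series_ge n) (series_ge 1)"
    then show "f \<in> series_ge (Suc n)"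
    proof induction
      case (prod i j)
      then show ?case using series_ge_mult [of i n j 1] by simp
    qed (auto intro: series_ge_add)
  next
    fix f :: "'k fps" assume "f \<in> series_ge (Suc n)"
    then obtain h where h: "\<And>g. h g \<in> series_ge n" "f = (\<Sum>g\<in>{n1, n2, n3, n4}. h g * fps_X ^ g)"
      using series_ge_SucE by auto
    interpret I: ideal "ideal_prod RS (series_ge n) (series_ge 1)" "RS :: 'k fps ring"
      by (intro ideal_prod_is_ideal ideal_series_ge)
    have "h g * fps_X ^ g \<in> ideal_prod RS (series_ge n) (series_ge 1)" if "g \<in> {n1, n2, n3, n4}" for g
      using ideal_prod.prod [of "h g" "series_ge n" "fps_X ^ g" "series_ge 1" RS] that h
        X_power_in_series_ge [of g 1] generator_in_order_ge by auto
    then show "f \<in> ideal_prod RS (series_ge n) (series_ge 1)"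
      unfolding h(2) by (intro sum_in_ideal [OF I.ideal_axioms])
  qed
  then show ?case by (simp only: ideal_power_Suc Suc)
qed

text \<open>A series of the ring outside \<open>series_ge 1\<close> has a nonzero constant term.
  Modulo \<open>series_ge 1\<close> it equals that constant, which is a unit.\<close>

lemma maximalideal_series_ge: "maximalideal (series_ge 1) (RS :: 'k::field fps ring)"
proof (rule maximalidealI [OF ideal_series_ge])
  show "carrier RS \<noteq> (series_ge 1 :: 'k fps set)"
  proof -
    have "(1 :: 'k fps) \<notin> series_ge 1" using order_ge_le [of 0 1] by (auto simp: series_ge_def)
    then show ?thesis using one_in_series_ge_0 by (auto simp: carrier_RS)
  qed
  fix J :: "'k fps set" assume J: "ideal J RS" "series_ge 1 \<subseteq> J" "J \<subseteq> carrier RS"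
  interpret J: ideal J "RS :: 'k fps ring" by fact
  show "J = series_ge 1 \<or> J = carrier RS"
  proof (cases "J \<subseteq> series_ge 1")
    case False
    then obtain f where f: "f \<in> J" "f \<notin> series_ge 1" by blast
    then have f0: "f \<in> series_ge 0" using J by (auto simp: carrier_RS)
    then have nz: "fps_nth f 0 \<noteq> 0" using f(2) in_order_ge_1 unfolding series_ge_def by force
    have "fps_const (fps_nth f 0) - f \<in> series_ge 0"
      using series_ge_add [OF const_in_series_ge_0 series_ge_uminus [OF f0]] by simp
    then have "fps_const (fps_nth f 0) - f \<in> series_ge 1"
      using in_order_ge_1 unfolding series_ge_def by force
    then have "(fps_const (fps_nth f 0) - f) \<oplus>\<^bsub>RS\<^esub> f \<in> J" using J f(1) J.a_closed by blast
    then have "fps_const (fps_nth f 0) \<in> J" by simp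
    then have "fps_const (inverse (fps_nth f 0)) \<otimes>\<^bsub>RS\<^esub> fps_const (fps_nth f 0) \<in> J"
      by (intro J.I_l_closed) (simp_all only: carrier_RS const_in_series_ge_0)
    then have "\<one>\<^bsub>RS\<^esub> \<in> J" using nz by simp
    then show ?thesis using J.one_imp_carrier by blast
  qed (use J in blast)
qed

text \<open>The cosets of the powers \<open>t^x\<close>, with \<open>x\<close> in
  \<open>order_ge n\<close> but not in \<open>order_ge (Suc n)\<close>, form a basis of the graded
  piece.\<close>

lemma hilbert_function_eq:
  "hilbert_function RS (series_ge 1 :: 'k::field fps set) n = card (order_ge n - order_ge (Suc n))"
proof -
  let ?m = "series_ge 1 :: 'k fps set" and ?J = "series_ge (Suc n) :: 'k fps set"
  let ?Q = "RS Quot ?m" and ?G = "graded_piece RS ?m n"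
  let ?A = "order_ge n - order_ge (Suc n)"
  interpret cring "RS :: 'k fps ring" by (rule cring_RS)
  interpret m: maximalideal ?m "RS :: 'k fps ring" by (rule maximalideal_series_ge)
  interpret J: ideal ?J "RS :: 'k fps ring" by (rule ideal_series_ge)
  interpret Q: field ?Q by (rule m.quotient_is_field) (rule is_cring)
  interpret G: Module.module ?Q ?G by (rule graded_piece_module) (rule ideal_series_ge)
  interpret V: vectorspace ?Q ?G ..
  note pw = ideal_power_series_ge
  note [simp del] = One_nat_def
  define cs where "cs f = ?J +>\<^bsub>RS\<^esub> f" for f :: "'k fps"
  have carrG: "carrier ?G = cs ` series_ge n" and zeroG: "\<zero>\<^bsub>?G\<^esub> = ?J"
    by (auto simp only: graded_piece_def pw cs_def module.simps ring.simps partial_object.simps)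
  have carrR: "f \<in> carrier RS" if "f \<in> series_ge j" for f :: "'k fps" and j
    using that series_ge_antimono [of 0 j] by (auto simp: carrier_RS)
  have cs_eq: "cs f = cs g \<longleftrightarrow> f - g \<in> ?J" if "f \<in> series_ge n" "g \<in> series_ge n" for f g
  proof -
    have "f \<ominus>\<^bsub>RS\<^esub> g = f - g"
      using carrR [OF that(1)] carrR [OF that(2)] minus_equality [of "- g" g]
        series_ge_uminus [of g 0] by (simp add: carrier_RS a_minus_def)
    then show ?thesis unfolding cs_def
      using J.a_rcos_module_minus [OF ring_axioms, of g f] J.a_rcos_self [of f]
        J.a_repr_independence' carrR that a_repr_independence J.a_subgroup by metis
  qed
  have cs_add: "cs f \<oplus>\<^bsub>?G\<^esub> cs g = cs (f + g)" if "f \<in> series_ge n" "g \<in> series_ge n" for f g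
    using J.a_rcos_sum carrR that by (simp add: graded_piece_def pw cs_def del: Group.nat_pow_Suc)
  have cs_0: "cs 0 = \<zero>\<^bsub>?G\<^esub>"
    unfolding zeroG cs_def using a_coset_add_zero [OF J.a_subset] by simp
  have cs_sum: "(\<Oplus>\<^bsub>?G\<^esub>x\<in>A. cs (f x)) = cs (sum f A)"
    if "finite A" "\<And>x. x \<in> A \<Longrightarrow> f x \<in> series_ge n" for A :: "nat set" and f
    using that
  proof (induction A rule: finite_induct)
    case (insert x A)
    then have "(\<Oplus>\<^bsub>?G\<^esub>x\<in>insert x A. cs (f x)) = cs (f x) \<oplus>\<^bsub>?G\<^esub> (\<Oplus>\<^bsub>?G\<^esub>x\<in>A. cs (f x))"
      by (intro G.finsum_insert) (auto simp: carrG)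
    with insert show ?case by (simp add: cs_add series_ge_sum)
  qed (simp add: cs_0)
  have smult: "(?m +>\<^bsub>RS\<^esub> r) \<odot>\<^bsub>?G\<^esub> cs f = cs (r * f)" if "r \<in> series_ge 0" "f \<in> series_ge n" for r f
    using graded_piece_smult [OF ideal_series_ge, of r f 1 n] that
    by (simp add: pw cs_def carrier_RS del: Group.nat_pow_Suc)
  define e where "e x = cs (fps_X ^ x)" for x
  have Xn: "fps_X ^ x \<in> (series_ge n :: 'k fps set)" if "x \<in> ?A" for x
    using that by (auto intro: X_power_in_series_ge)
  have inj: "inj_on e ?A"
  proof (rule inj_onI, rule ccontr)
    fix x y assume xy: "x \<in> ?A" "y \<in> ?A" "e x = e y" "x \<noteq> y"
    then have "fps_X ^ x - fps_X ^ y \<in> ?J" using cs_eq Xn unfolding e_def by blast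
    moreover have "fps_nth (fps_X ^ x - fps_X ^ y :: 'k fps) x \<noteq> 0" using xy by (simp add: fps_X_power_nth)
    ultimately show False using xy by (auto simp: series_ge_def)
  qed
  have finA: "finite ?A" by (rule finite_order_eq)
  have Bcarr: "e ` ?A \<subseteq> carrier ?G" using Xn by (auto simp: carrG e_def)
  \<comment> \<open>Lifting the scalars from the residue field to representatives in the ring turns
    a linear combination into the coset of one series, whose coefficients can then be
    inspected.\<close>
  have lincomb_e: "G.lincomb a (e ` ?A) = cs (\<Sum>x\<in>?A. r x * fps_X ^ x)"
    if r: "\<And>x. x \<in> ?A \<Longrightarrow> r x \<in> series_ge 0" "\<And>x. x \<in> ?A \<Longrightarrow> a (e x) = ?m +>\<^bsub>RS\<^esub> r x" for a r
  proof -
    have rX: "r x * fps_X ^ x \<in> series_ge n" if "x \<in> ?A" for x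
      using series_ge_mult [OF r(1) [OF that] Xn [OF that]] by simp
    have ae: "a (e x) \<odot>\<^bsub>?G\<^esub> e x = cs (r x * fps_X ^ x)" if "x \<in> ?A" for x
      using that r Xn by (simp add: e_def smult)
    have "G.lincomb a (e ` ?A) = (\<Oplus>\<^bsub>?G\<^esub>x\<in>?A. a (e x) \<odot>\<^bsub>?G\<^esub> e x)"
      unfolding G.lincomb_def
      by (rule G.finsum_reindex [OF _ inj]) (use ae rX carrG in auto)
    also have "\<dots> = (\<Oplus>\<^bsub>?G\<^esub>x\<in>?A. cs (r x * fps_X ^ x))"
      by (rule G.finsum_cong') (use ae rX carrG in auto)
    also have "\<dots> = cs (\<Sum>x\<in>?A. r x * fps_X ^ x)" by (rule cs_sum [OF finA rX])
    finally show ?thesis .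
  qed
  have carrQ: "carrier ?Q = (\<lambda>r. ?m +>\<^bsub>RS\<^esub> r) ` series_ge 0"
    by (auto simp: FactRing_def A_RCOSETS_def' carrier_RS)
  have "V.basis (e ` ?A)"
    unfolding V.basis_def
  proof (intro conjI Bcarr)
    show "G.lin_indpt (e ` ?A)"
    proof (rule G.finite_lin_indpt2 [OF _ Bcarr])
      fix a assume a: "a \<in> e ` ?A \<rightarrow> carrier ?Q" and 0: "G.lincomb a (e ` ?A) = \<zero>\<^bsub>?G\<^esub>"
      have "\<forall>x\<in>?A. \<exists>q. q \<in> series_ge 0 \<and> a (e x) = ?m +>\<^bsub>RS\<^esub> q"
        using a by (auto simp: carrQ Pi_def)
      then obtain r where r: "\<And>x. x \<in> ?A \<Longrightarrow> r x \<in> series_ge 0" "\<And>x. x \<in> ?A \<Longrightarrow> a (e x) = ?m +>\<^bsub>RS\<^esub> r x"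
        by metis
      have rX: "r x * fps_X ^ x \<in> series_ge n" if "x \<in> ?A" for x
        using series_ge_mult [OF r(1) [OF that] Xn [OF that]] by simp
      have "cs (\<Sum>x\<in>?A. r x * fps_X ^ x) = cs 0"
        using lincomb_e [of r a, OF r] 0 cs_0 by simp
      then have sumJ: "(\<Sum>x\<in>?A. r x * fps_X ^ x) \<in> ?J"
        using cs_eq [of "\<Sum>x\<in>?A. r x * fps_X ^ x" 0] series_ge_sum [of ?A "\<lambda>x. r x * fps_X ^ x" n] rX
        by simp
      have "r x \<in> ?m" if x: "x \<in> ?A" for x
      proof -
        \<comment> \<open>For \<open>y < x\<close> a nonzero contribution would make
          \<open>x - y\<close> a nonzero semigroup element, and adding it to \<open>y\<close> would
          put \<open>x\<close> into \<open>order_ge (Suc n)\<close>. Hence only the constant term of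
          \<open>r x\<close> is seen at \<open>x\<close>.\<close>
        have "fps_nth (r y * fps_X ^ y) x = (if y = x then fps_nth (r x) 0 else 0)" if y: "y \<in> ?A" for y
        proof -
          have "fps_nth (r y) (x - y) = 0" if "y < x"
          proof (rule ccontr)
            assume "fps_nth (r y) (x - y) \<noteq> 0"
            then have "x - y \<in> order_ge 1" using r(1) [OF y] that in_order_ge_1 by (auto simp: series_ge_def)
            then have "(x - y) + y \<in> order_ge (1 + n)" using y by (intro order_ge_add) auto
            then show False using that x by (simp add: plus_1_eq_Suc)
          qed
          then show ?thesis by (auto simp: fps_X_power_mult_right_nth)
        qed
        then have "fps_nth (\<Sum>y\<in>?A. r y * fps_X ^ y) x = fps_nth (r x) 0"
          using x finA by (simp add: fps_sum_nth)
        then have "fps_nth (r x) 0 = 0"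
          using sumJ x unfolding series_ge_def by (metis (mono_tags, lifting) DiffD2 mem_Collect_eq)
        then show ?thesis
          using r(1) [OF x] in_order_ge_1 unfolding series_ge_def by force
      qed
      then show "\<forall>v\<in>e ` ?A. a v = \<zero>\<^bsub>?Q\<^esub>"
        using r(2) m.a_rcos_const by (auto simp: FactRing_def)
    qed (simp add: finA)
    show "G.span (e ` ?A) = carrier ?G"
    proof
      show "G.span (e ` ?A) \<subseteq> carrier ?G" using Bcarr by (rule G.span_is_subset2)
      show "carrier ?G \<subseteq> G.span (e ` ?A)"
      proof
        fix v assume "v \<in> carrier ?G"
        then obtain f where f: "f \<in> series_ge n" "v = cs f" by (auto simp: carrG)
        \<comment> \<open>Constants suffice as scalars: removing the terms of \<open>f\<close> at
          the exponents in \<open>?A\<close> leaves only exponents in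
          \<open>order_ge (Suc n)\<close>.\<close>
        define r where "r x = fps_const (fps_nth f x)" for x
        define a where "a w = ?m +>\<^bsub>RS\<^esub> r (the_inv_into ?A e w)" for w
        have a: "a (e x) = ?m +>\<^bsub>RS\<^esub> r x" if "x \<in> ?A" for x
          using the_inv_into_f_f [OF inj that] by (simp add: a_def)
        have r: "r x \<in> series_ge 0" for x by (simp add: r_def const_in_series_ge_0)
        have sn: "(\<Sum>x\<in>?A. r x * fps_X ^ x) \<in> series_ge n"
          using series_ge_mult [OF r Xn] by (intro series_ge_sum) auto
        have nth: "fps_nth (\<Sum>x\<in>?A. r x * fps_X ^ x) k = (if k \<in> ?A then fps_nth f k else 0)" for k
        proof -
          have "fps_nth (\<Sum>x\<in>?A. r x * fps_X ^ x) k = (\<Sum>x\<in>?A. if k = x then fps_nth f k else 0)"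
            by (auto simp: fps_sum_nth r_def fps_X_power_nth intro!: sum.cong)
          then show ?thesis using finA by (simp add: sum.delta')
        qed
        have "(\<Sum>x\<in>?A. r x * fps_X ^ x) - f \<in> ?J"
          using f(1) nth by (auto simp: series_ge_def)
        then have "G.lincomb a (e ` ?A) = v"
          using lincomb_e [of r a] a r cs_eq [OF sn f(1)] f(2) by simp
        then show "v \<in> G.span (e ` ?A)"
          using a r finA by (subst G.finite_span [OF _ Bcarr]) (auto simp: carrQ intro!: exI [of _ a])
      qed
    qed
  qed
  then have "V.dim = card (e ` ?A)" using finA by (intro V.dim_basis) auto
  then show ?thesis unfolding hilbert_function_def by (simp add: card_image [OF inj])
qed

end

section \<open>Normal forms of factorizations\<close>

text \<open>The parameter formulas with the fourth parameter set to 3. Those for \<open>n3\<close>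
  and \<open>n4\<close> are recast as integer combinations of \<open>n1\<close> and
  \<open>n2\<close>, from which the lattice of relations is visible. The facts
  \<open>coprime\<close>, \<open>s_le\<close> and \<open>l_less\<close> are consequences of the
  hypotheses, derived when the locale is interpreted.\<close>

locale pseudo_symmetric_generators = numerical_generators +
  fixes a b c d s l :: nat
  assumes param_pos: "1 \<le> d" "d + 1 < b" "2 \<le> c" "d + 1 < a"
    and n1_eq: "int n1 = 2 * int b * int c + 1"
    and n2_eq: "int n2 = (int c - 1) * (int a + 2 * int d) + 3 * int d + 1"
    and n3_eq: "int n3 = (int a + 2 * int d) * int n1 - 2 * int b * int n2"
    and n4_eq: "int n4 = int b * int n2 - int d * int n1"
    and increasing: "n1 < n2" "n2 < n3" "n3 < n4"
    and coprime: "coprime n1 n2"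
    and s_le: "s \<le> l" and l_less: "l < c"
    and s_sat: "(2 * s + 1) * b + (s + 2) < s * a + (2 * s + 2) * d + c"
    and s_min: "J < s \<Longrightarrow> J * a + (2 * J + 2) * d + c \<le> (2 * J + 1) * b + (J + 2)"
    and l_sat: "(2 * l + 2) * b + (l + 1) < l * a + (2 * l + 3) * d + c"
    and l_min: "J < l \<Longrightarrow> J * a + (2 * J + 3) * d + c \<le> (2 * J + 2) * b + (J + 1)"
begin

text \<open>The power of \<open>X1\<close> at which its product with \<open>X3^(c-1-J)\<close>
  becomes reducible. For \<open>J < s\<close> the target is \<open>X2^((2J+1)b+1) X4\<close>,
  otherwise \<open>X2^((2J+2)b+1)\<close>; the first relation needs \<open>d\<close> fewer factors
  \<open>X1\<close>.\<close>

definition bound :: "nat \<Rightarrow> nat" where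
  "bound J = (if J < s then J * a + (2 * J + 2) * d + 1 else J * a + (2 * J + 3) * d + 1)"

text \<open>The exponents of the monomials divisible by no left-hand side of a rewriting rule,
  sorted by the exponent \<open>m\<close> of \<open>X4\<close>.\<close>

fun standard :: "nat \<times> nat \<times> nat \<times> nat \<Rightarrow> bool" where
  "standard (i, j, k, m) \<longleftrightarrow>
     m = 2 \<and> i < d \<and> j = 0 \<and> k = 0 \<or>
     m = 1 \<and> i < d \<and> (k = 0 \<and> j \<le> (2 * s + 1) * b \<or> 1 \<le> k \<and> k < c \<and> j < b) \<or>
     m = 0 \<and> (k = 0 \<and> j \<le> (2 * l + 2) * b \<or>
       1 \<le> k \<and> k < c \<and> j < 2 * b \<and> (\<forall>J<l. k + J + 1 = c \<longrightarrow> i < bound J))"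

fun value4 :: "nat \<times> nat \<times> nat \<times> nat \<Rightarrow> nat" where
  "value4 (i, j, k, m) = val i j k m"

fun degree4 :: "nat \<times> nat \<times> nat \<times> nat \<Rightarrow> nat" where
  "degree4 (i, j, k, m) = i + j + k + m"

section \<open>Uniqueness of normal forms\<close>

lemma int_val: "int (val i j k m) = int i * int n1 + int j * int n2 + int k * int n3 + int m * int n4"
  by (simp add: val_def)

lemma int_bound: "int (bound J) = int J * (int a + 2 * int d) + (if J < s then 2 else 3) * int d + 1"
  by (simp add: bound_def algebra_simps)

text \<open>Modulo \<open>n1\<close> the generators are the multiples \<open>0, 1, - 2b, b\<close> of \<open>n2\<close>; the first equation below
  compares residues, the second the remaining multiples of \<open>n1\<close>.\<close>

lemma val_eq_lattice:
  assumes "val i j k m = val i' j' k' m'"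
  obtains q where
    "int j - 2 * int b * int k + int b * int m = int j' - 2 * int b * int k' + int b * int m' + q * int n1"
    "int i + (int a + 2 * int d) * int k - int d * int m
      = int i' + (int a + 2 * int d) * int k' - int d * int m' - q * int n2"
proof -
  define \<phi> where "\<phi> j k m = int j - 2 * int b * int k + int b * int m" for j k m
  define \<psi> where "\<psi> i k m = int i + (int a + 2 * int d) * int k - int d * int m" for i k m
  have decomp: "int (val i j k m) = \<psi> i k m * int n1 + \<phi> j k m * int n2" for i j k m
    unfolding int_val \<phi>_def \<psi>_def n3_eq n4_eq by (simp add: algebra_simps)
  have eq: "(\<phi> j k m - \<phi> j' k' m') * int n2 = (\<psi> i' k' m' - \<psi> i k m) * int n1"
    using decomp [of i j k m] decomp [of i' j' k' m'] assms by (simp add: algebra_simps)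
  then have "int n1 dvd (\<phi> j k m - \<phi> j' k' m') * int n2" by simp
  then have "int n1 dvd \<phi> j k m - \<phi> j' k' m'"
    using coprime by (simp add: coprime_dvd_mult_left_iff)
  then obtain q where q: "\<phi> j k m - \<phi> j' k' m' = int n1 * q" by auto
  with eq have "q * int n2 = \<psi> i' k' m' - \<psi> i k m"
    using pos by simp
  with q show ?thesis
    by (intro that [of q]) (auto simp: \<phi>_def \<psi>_def algebra_simps)
qed

text \<open>For \<open>k > 0\<close> the quantity \<open>j + b m\<close> is a remainder modulo
  \<open>2b\<close>. The last bound keeps \<open>j - 2bk + bm\<close> between \<open>-2bc\<close>
  and \<open>2bc\<close>, where \<open>n1 = 2bc + 1\<close>.\<close>

lemma standard_bounds:
  assumes "standard (i, j, k, m)"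
  shows "m \<le> 2" "k < c" "m > 0 \<Longrightarrow> i < d" "k > 0 \<Longrightarrow> j + b * m < 2 * b" "j + b * m \<le> 2 * b * c"
proof -
  have "(2 * l + 2) * b \<le> 2 * b * c" "(2 * s + 1) * b + b \<le> 2 * b * c"
    using mult_le_mono2 [of "l + 1" c "2 * b"] mult_le_mono2 [of "s + 1" c "2 * b"] s_le l_less
    by (auto simp: algebra_simps)
  moreover have "2 * b \<le> 2 * b * c" using param_pos by simp
  ultimately show "m \<le> 2" "k < c" "m > 0 \<Longrightarrow> i < d" "k > 0 \<Longrightarrow> j + b * m < 2 * b" "j + b * m \<le> 2 * b * c"
    using assms param_pos by (auto simp: algebra_simps)
qed

text \<open>Excludes \<open>q = 1\<close> in \<open>val_eq_lattice\<close>. A shift by all of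
  \<open>n1\<close> forces \<open>k = 0 < k'\<close>; the size of \<open>j\<close> then limits
  \<open>J = c - 1 - k'\<close>, and the second equation makes \<open>i'\<close> too large for a
  normal form.\<close>

lemma standard_no_shift:
  assumes u: "standard (i, j, k, m)" and u': "standard (i', j', k', m')"
    and \<phi>: "int j - 2 * int b * int k + int b * int m
      = int j' - 2 * int b * int k' + int b * int m' + int n1"
    and \<psi>: "int i + (int a + 2 * int d) * int k - int d * int m
      = int i' + (int a + 2 * int d) * int k' - int d * int m' - int n2"
  shows False
proof -
  note B = standard_bounds [OF u] and B' = standard_bounds [OF u']
  define N where "N = 2 * b"
  have N: "N > 0" using param_pos by (simp add: N_def)
  have "N * k' + N \<le> N * c" using B'(2) mult_le_mono2 [of "k' + 1" c N] by simp
  moreover have "int (j + b * m + N * k') = int (j' + b * m' + N * k + N * c + 1)"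
    using \<phi> unfolding n1_eq N_def by (simp add: algebra_simps)
  then have \<phi>': "j + b * m + N * k' = j' + b * m' + N * k + N * c + 1"
    by (simp only: of_nat_eq_iff)
  moreover have "j + b * m < N * k" if "k > 0"
    using less_le_trans [OF B(4) [OF that], of "N * k"] that by (simp add: N_def)
  ultimately have k: "k = 0" by (cases "k = 0") auto
  have "k' \<noteq> 0"
  proof
    assume "k' = 0"
    then show False using \<phi>' B(5) by (simp add: k N_def)
  qed
  define J where "J = c - 1 - k'"
  have J: "k' + J + 1 = c" using B'(2) by (simp add: J_def)
  have \<rho>: "j + b * m = j' + b * m' + N * (J + 1) + 1"
    using \<phi>' by (simp add: k J [symmetric] algebra_simps)
  have "int c - 1 = int k' + int J" using J by simp
  then have i': "int i' = int i - int d * int m + int d * int m' + int J * (int a + 2 * int d) + 3 * int d + 1"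
    using \<psi> unfolding n2_eq by (simp add: k algebra_simps)
  have Ja: "int J * (int a + 2 * int d) \<ge> 0" by simp
  consider "m = 0" | "m = 1" | "m = 2" using B(1) by linarith
  then show False
  proof cases
    case 1
    then have "j \<le> (2 * l + 2) * b" using u k by auto
    then have "j \<le> N * (l + 1)" by (simp add: N_def algebra_simps)
    moreover have "j = j' + b * m' + N * (J + 1) + 1" using \<rho> 1 by simp
    ultimately have "N * (J + 1) < N * (l + 1)" by linarith
    then have "J < l" by simp
    show False
    proof (cases "m' = 0")
      case True
      then have "i' < bound J" using u' \<open>k' \<noteq> 0\<close> \<open>J < l\<close> J by auto
      then have "int i' < int J * (int a + 2 * int d) + 3 * int d + 1"
        using int_bound [of J] by (simp split: if_splits)
      then show False using i' 1 True by simp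
    next
      case False
      then have "int d * int m' \<ge> int d" "int i' < int d" using B'(3) by auto
      moreover have "int i' = int i + int d * int m' + int J * (int a + 2 * int d) + 3 * int d + 1"
        using i' 1 by simp
      ultimately show False using Ja by linarith
    qed
  next
    case 2
    then have "j \<le> (2 * s + 1) * b" using u k by auto
    then have "j + b \<le> N * (s + 1)" by (simp add: N_def algebra_simps)
    moreover have "j + b = j' + b * m' + N * (J + 1) + 1" using \<rho> 2 by simp
    ultimately have "N * (J + 1) < N * (s + 1)" by linarith
    then have "J < s" by simp
    show False
    proof (cases "m' = 0")
      case True
      then have "i' < bound J" using u' \<open>k' \<noteq> 0\<close> \<open>J < s\<close> s_le J by auto
      then have "int i' < int J * (int a + 2 * int d) + 2 * int d + 1"
        using int_bound [of J] \<open>J < s\<close> by simp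
      then show False using i' 2 True by simp
    next
      case False
      then have "int d * int m' \<ge> int d" "int i' < int d" using B'(3) by auto
      moreover have "int i' = int i - int d + int d * int m' + int J * (int a + 2 * int d) + 3 * int d + 1"
        using i' 2 by simp
      ultimately show False using Ja by linarith
    qed
  next
    case 3
    then have "j = 0" using u by auto
    then show False using \<rho> 3 by (simp add: N_def)
  qed
qed

lemma standard_inj: "inj_on value4 (Collect standard)"
proof (rule inj_onI)
  fix v v' assume v: "v \<in> Collect standard" "v' \<in> Collect standard" "value4 v = value4 v'"
  obtain i j k m where v_eq: "v = (i, j, k, m)" by (cases v)
  obtain i' j' k' m' where v'_eq: "v' = (i', j', k', m')" by (cases v')
  have u: "standard (i, j, k, m)" and u': "standard (i', j', k', m')"
    and val: "value4 (i, j, k, m) = value4 (i', j', k', m')"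
    using v unfolding v_eq v'_eq by blast+
  note B = standard_bounds [OF u] and B' = standard_bounds [OF u']
  define N where "N = 2 * b"
  have N: "N > 0" using param_pos by (simp add: N_def)
  obtain q where \<phi>: "int j - 2 * int b * int k + int b * int m
      = int j' - 2 * int b * int k' + int b * int m' + q * int n1"
    and \<psi>: "int i + (int a + 2 * int d) * int k - int d * int m
      = int i' + (int a + 2 * int d) * int k' - int d * int m' - q * int n2"
    using val by (auto elim: val_eq_lattice)
  have range: "int x - 2 * int b * int z + int b * int w \<le> 2 * int b * int c"
    "- 2 * int b * int c \<le> int x - 2 * int b * int z + int b * int w" if "standard (y, x, z, w)" for x y z w
  proof -
    have "b * z \<le> b * c" "j + b * m \<ge> 0" using standard_bounds(2) [OF that] by auto
    then have "int b * int z \<le> int b * int c" by (metis of_nat_le_iff of_nat_mult)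
    moreover have "int x + int b * int w \<le> 2 * int b * int c"
      using standard_bounds(5) [OF that] by (metis of_nat_add of_nat_le_iff of_nat_mult of_nat_numeral)
    moreover have "0 \<le> int b * int z" "0 \<le> int b * int w" by simp_all
    ultimately show "int x - 2 * int b * int z + int b * int w \<le> 2 * int b * int c"
      "- 2 * int b * int c \<le> int x - 2 * int b * int z + int b * int w" by linarith+
  qed
  \<comment> \<open>Two numbers between \<open>-2bc\<close> and \<open>2bc\<close> differ by at most
    \<open>4bc = 2 n1 - 2\<close>.\<close>
  have "\<bar>q * int n1\<bar> < 2 * int n1"
    using range [OF u] range [OF u'] \<phi> by (simp add: n1_eq)
  then have "\<bar>q\<bar> * int n1 < 2 * int n1" by (simp add: abs_mult)
  then have "\<bar>q\<bar> < 2" using mult_less_cancel_right_pos [of "int n1" "\<bar>q\<bar>" 2] pos by simp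
  then consider "q = 1" | "q = -1" | "q = 0" by linarith
  then have q: "q = 0"
  proof cases
    case 1
    then show ?thesis using standard_no_shift [OF u u'] \<phi> \<psi> by simp
  next
    case 2
    then show ?thesis using standard_no_shift [OF u' u] \<phi> \<psi> by simp
  qed
  have "int (j + b * m + N * k') = int (j' + b * m' + N * k)"
    using \<phi> unfolding q N_def by (simp add: algebra_simps)
  then have \<phi>': "j + b * m + N * k' = j' + b * m' + N * k"
    by (simp only: of_nat_eq_iff)
  have aux: "k1 = k2" if "r1 + N * k2 = r2 + N * k1" "k1 > 0 \<Longrightarrow> r1 < N" "k2 > 0 \<Longrightarrow> r2 < N" for r1 r2 k1 k2
  proof (rule ccontr)
    assume "k1 \<noteq> k2"
    then consider "k1 < k2" | "k2 < k1" by linarith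
    then show False
    proof cases
      case 1
      then have "N * (k1 + 1) \<le> N * k2" by (intro mult_le_mono2) simp
      then show False using that 1 by simp
    next
      case 2
      then have "N * (k2 + 1) \<le> N * k1" by (intro mult_le_mono2) simp
      then show False using that 2 by simp
    qed
  qed
  have k: "k = k'"
    by (rule aux [OF \<phi>']) (use B(4) B'(4) in \<open>simp_all add: N_def\<close>)
  have i: "int i - int d * int m = int i' - int d * int m'" using \<psi> q k by simp
  \<comment> \<open>Since \<open>i < d\<close> whenever \<open>m > 0\<close>, the values
    \<open>i - d m\<close> for \<open>m = 0, 1, 2\<close> lie in the disjoint ranges
    \<open>[0, oo)\<close>, \<open>[-d, 0)\<close> and \<open>[-2d, -d)\<close>.\<close>
  have m: "m = m'"
  proof (rule ccontr)
    assume "m \<noteq> m'"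
    then consider "m = 0" "m' = 1" | "m = 0" "m' = 2" | "m = 1" "m' = 0" | "m = 1" "m' = 2"
      | "m = 2" "m' = 0" | "m = 2" "m' = 1"
      using B(1) B'(1) by linarith
    then show False using i B(3) B'(3) by cases auto
  qed
  show "v = v'"
    unfolding v_eq v'_eq using i m k \<phi>' by simp
qed

text \<open>Ties in degree are broken by the exponent of \<open>X1\<close>: for \<open>J < l\<close> the relation rewriting
  \<open>X1^(bound J) X3^(c-1-J)\<close> may preserve the degree.\<close>

definition reducible :: "nat \<Rightarrow> nat \<Rightarrow> nat \<Rightarrow> nat \<Rightarrow> bool" where
  "reducible i j k m \<longleftrightarrow> (\<exists>i' j' k' m'. val i' j' k' m' = val i j k m \<and>
     (i + j + k + m < i' + j' + k' + m' \<or> i + j + k + m = i' + j' + k' + m' \<and> i' < i))"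

lemma reducibleI:
  assumes "val i' j' k' m' = val i j k m"
    and "i + j + k + m < i' + j' + k' + m' \<or> i + j + k + m = i' + j' + k' + m' \<and> i' < i"
  shows "reducible i j k m"
  using assms by (auto simp: reducible_def)

lemma reducible_mono:
  assumes "reducible i j k m" "i \<le> i'" "j \<le> j'" "k \<le> k'" "m \<le> m'"
  shows "reducible i' j' k' m'"
proof -
  obtain x y z w where x: "val x y z w = val i j k m"
    "i + j + k + m < x + y + z + w \<or> i + j + k + m = x + y + z + w \<and> x < i"
    using assms(1) by (auto simp: reducible_def)
  show ?thesis
  proof (rule reducibleI)
    obtain i'' j'' k'' m'' where "i' = i + i''" "j' = j + j''" "k' = k + k''" "m' = m + m''"
      using assms(2-) by (auto simp: le_iff_add)
    then show "val (x + (i' - i)) (y + (j' - j)) (z + (k' - k)) (w + (m' - m)) = val i' j' k' m'"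
      using x(1) by (simp add: val_def algebra_simps)
  qed (use x(2) assms(2-) in linarith)
qed


section \<open>The rewriting rules\<close>

lemma relation_X3:
  assumes "k + J + 1 = c"
  shows "int k * int n3 + (int J * (int a + 2 * int d) + 3 * int d + 1) * int n1
    = (2 * int b * (int J + 1) + 1) * int n2"
proof -
  have k: "int k = int c - 1 - int J" using assms by simp
  have "int k * int n3 + (int J * (int a + 2 * int d) + 3 * int d + 1) * int n1
    = ((int c - 1) * (int a + 2 * int d) + 3 * int d + 1) * int n1 - 2 * int b * int k * int n2"
    unfolding n3_eq k by (simp add: algebra_simps)
  \<comment> \<open>The bracket multiplying \<open>n1\<close> is the formula for \<open>n2\<close>,
    so \<open>n2\<close> factors out; inserting \<open>n1 = 2bc + 1\<close> finishes.\<close>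
  also have "\<dots> = (int n1 - 2 * int b * int k) * int n2"
    unfolding n2_eq [symmetric] by (simp add: algebra_simps)
  also have "\<dots> = (2 * int b * (int J + 1) + 1) * int n2"
    unfolding n1_eq k by (simp add: algebra_simps)
  finally show ?thesis .
qed

lemma val_eqI: "int (val i j k m) = int (val i' j' k' m') \<Longrightarrow> val i j k m = val i' j' k' m'"
  by simp

text \<open>The case \<open>J = 0\<close> of \<open>relation_X3\<close> with one further
  \<open>n3\<close> added on both sides.\<close>

lemma relation_X3_c: "int c * int n3 = (int a - int d - 1) * int n1 + int n2"
proof -
  have "int (c - 1) = int c - 1" using param_pos by simp
  then have "(int c - 1) * int n3 + (3 * int d + 1) * int n1 = (2 * int b + 1) * int n2"
    using relation_X3 [of "c - 1" 0] param_pos by simp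
  then show ?thesis by (simp add: n3_eq algebra_simps)
qed

text \<open>As in several rules below, the longer length follows from the order of the generators:
  the same value made from smaller generators needs more of them.\<close>

lemma reducible_X3X4X4: "reducible 0 0 1 2"
proof (rule reducibleI)
  show eq: "val a 0 0 0 = val 0 0 1 2"
    by (rule val_eqI) (simp add: int_val n3_eq n4_eq algebra_simps)
  have "3 * n1 < a * n1" using eq increasing unfolding val_def distrib_right by linarith
  then have "3 < a" by simp
  then show "0 + 0 + 1 + 2 < a + 0 + 0 + 0 \<or> 0 + 0 + 1 + 2 = a + 0 + 0 + 0 \<and> a < 0" by simp
qed

text \<open>The replacement is \<open>X2^b\<close>; it is longer because
  \<open>d + 1 < b\<close>.\<close>

lemma reducible_X1X4: "reducible d 0 0 1"
proof (rule reducibleI)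
  show "val 0 b 0 0 = val d 0 0 1"
    by (rule val_eqI) (simp add: int_val n4_eq)
qed (use param_pos in simp)

lemma reducible_X3: "reducible 0 0 c 0"
proof (rule reducibleI)
  show eq: "val (a - d - 1) 1 0 0 = val 0 0 c 0"
    using param_pos by (intro val_eqI) (simp add: int_val relation_X3_c)
  have "(a - d - 1) * n1 \<le> (a - d - 1) * n3" using increasing by simp
  then have "c * n3 < (a - d - 1) * n3 + n3" using eq increasing unfolding val_def distrib_right by linarith
  also have "\<dots> = (a - d - 1 + 1) * n3" by (simp add: algebra_simps)
  finally have "c < a - d - 1 + 1" by (simp only: mult_less_cancel2)
  then show "0 + 0 + c + 0 < a - d - 1 + 1 + 0 + 0 \<or> 0 + 0 + c + 0 = a - d - 1 + 1 + 0 + 0 \<and> a - d - 1 < 0"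
    by simp
qed

lemma reducible_X4: "reducible 0 0 0 3"
proof (rule reducibleI)
  have c3: "(int c - 1) * int n3 = (int a - int d - 1) * int n1 + int n2 - int n3"
    using relation_X3_c by (simp add: algebra_simps)
  show eq: "val 1 (b - 1) (c - 1) 0 = val 0 0 0 3"
    using param_pos c3
    by (intro val_eqI) (simp add: int_val of_nat_diff n3_eq n4_eq algebra_simps)
  have "(b - 1) * n2 \<le> (b - 1) * n4" "(c - 1) * n3 \<le> (c - 1) * n4" using increasing by simp_all
  then have "3 * n4 < n4 + (b - 1) * n4 + (c - 1) * n4"
    using eq increasing unfolding val_def distrib_right by linarith
  also have "\<dots> = (1 + (b - 1) + (c - 1)) * n4" by (simp add: algebra_simps)
  finally have "3 < 1 + (b - 1) + (c - 1)" by (simp only: mult_less_cancel2)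
  then show "0 + 0 + 0 + 3 < 1 + (b - 1) + (c - 1) + 0 \<or>
      0 + 0 + 0 + 3 = 1 + (b - 1) + (c - 1) + 0 \<and> (1::nat) < 0" by simp
qed

lemma reducible_X2X4X4: "reducible 0 1 0 2"
proof (rule reducibleI)
  have c3: "(int c - 1) * int n3 = (int a - int d - 1) * int n1 + int n2 - int n3"
    using relation_X3_c by (simp add: algebra_simps)
  show eq: "val (d + 1) 0 (c - 1) 0 = val 0 1 0 2"
    using param_pos c3
    by (intro val_eqI) (simp add: int_val of_nat_diff n3_eq n4_eq algebra_simps)
  \<comment> \<open>The new degree is \<open>d + c\<close>, which exceeds 3 except when
    \<open>d = 1\<close> and \<open>c = 2\<close>. Then \<open>2 n1 + n3 = n2 + 2 n4\<close> would
    contradict the order of the generators.\<close>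
  have "\<not> (d = 1 \<and> c = 2)" using eq increasing by (auto simp: val_def)
  then show "0 + 1 + 0 + 2 < d + 1 + 0 + (c - 1) + 0 \<or>
      0 + 1 + 0 + 2 = d + 1 + 0 + (c - 1) + 0 \<and> d + 1 < 0"
    using param_pos by linarith
qed

lemma reducible_X2X3X4: "reducible 0 b 1 1"
proof (rule reducibleI)
  show eq: "val (a + d) 0 0 0 = val 0 b 1 1"
    by (rule val_eqI) (simp add: int_val n3_eq n4_eq algebra_simps)
  have "b * n1 \<le> b * n2" using increasing by simp
  then have "(b + 2) * n1 < (a + d) * n1" using eq increasing unfolding val_def distrib_right by linarith
  then have "b + 2 < a + d" by (simp only: mult_less_cancel2)
  then show "0 + b + 1 + 1 < a + d + 0 + 0 + 0 \<or> 0 + b + 1 + 1 = a + d + 0 + 0 + 0 \<and> a + d < 0"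
    by simp
qed

lemma reducible_X2X3: "reducible 0 (2 * b) 1 0"
proof (rule reducibleI)
  show eq: "val (a + 2 * d) 0 0 0 = val 0 (2 * b) 1 0"
    by (rule val_eqI) (simp add: int_val n3_eq algebra_simps)
  have "2 * b * n1 \<le> 2 * b * n2" using increasing by simp
  then have "(2 * b + 1) * n1 < (a + 2 * d) * n1" using eq increasing unfolding val_def distrib_right by linarith
  then have "2 * b + 1 < a + 2 * d" by (simp only: mult_less_cancel2)
  then show "0 + 2 * b + 1 + 0 < a + 2 * d + 0 + 0 + 0 \<or>
      0 + 2 * b + 1 + 0 = a + 2 * d + 0 + 0 + 0 \<and> a + 2 * d < 0" by simp
qed

lemma val_X1X3_eq_X2X4:
  assumes "k + J + 1 = c"
  shows "val (J * a + (2 * J + 2) * d + 1) 0 k 0 = val 0 ((2 * J + 1) * b + 1) 0 1"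
  using relation_X3 [OF assms] by (intro val_eqI) (simp add: int_val n4_eq algebra_simps)

lemma val_X1X3_eq_X2:
  assumes "k + J + 1 = c"
  shows "val (J * a + (2 * J + 3) * d + 1) 0 k 0 = val 0 ((2 * J + 2) * b + 1) 0 0"
  using relation_X3 [OF assms] by (intro val_eqI) (simp add: int_val algebra_simps)

text \<open>Minimality of \<open>s\<close> and of \<open>l\<close> says exactly that these
  replacements do not shorten. Equality of degrees is possible, but the exponent of
  \<open>X1\<close> drops to 0.\<close>

lemma reducible_X1X3:
  assumes "k + J + 1 = c" "J < l"
  shows "reducible (bound J) 0 k 0"
proof (cases "J < s")
  case True
  then show ?thesis
    unfolding bound_def using val_X1X3_eq_X2X4 [OF assms(1)] s_min [OF True] assms(1)
    by (intro reducibleI [of 0 "(2 * J + 1) * b + 1" 0 1]) auto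
next
  case False
  then show ?thesis
    unfolding bound_def using val_X1X3_eq_X2 [OF assms(1)] l_min [OF assms(2)] assms(1)
    by (intro reducibleI [of 0 "(2 * J + 2) * b + 1" 0 0]) auto
qed

text \<open>The relation used for \<open>J < s\<close>, taken at \<open>J = s\<close> and read
  backwards: there the defining inequality of \<open>s\<close> makes the side with \<open>X1\<close>
  and \<open>X3\<close> strictly longer. The next rule does the same with \<open>l\<close>.\<close>

lemma reducible_X2X4: "reducible 0 ((2 * s + 1) * b + 1) 0 1"
  using val_X1X3_eq_X2X4 [of "c - 1 - s" s] s_sat s_le l_less
  by (intro reducibleI [of "s * a + (2 * s + 2) * d + 1" 0 "c - 1 - s" 0]) auto

lemma reducible_X2: "reducible 0 ((2 * l + 2) * b + 1) 0 0"
  using val_X1X3_eq_X2 [of "c - 1 - l" l] l_sat l_less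
  by (intro reducibleI [of "l * a + (2 * l + 3) * d + 1" 0 "c - 1 - l" 0]) auto

lemma standard_if_irreducible:
  assumes irr: "\<not> reducible i j k m"
  shows "standard (i, j, k, m)"
proof -
  have R: "\<not> (i0 \<le> i \<and> j0 \<le> j \<and> k0 \<le> k \<and> m0 \<le> m)" if "reducible i0 j0 k0 m0" for i0 j0 k0 m0
    using reducible_mono [OF that] irr by blast
  note r = R [OF reducible_X3X4X4] R [OF reducible_X1X4] R [OF reducible_X3] R [OF reducible_X4]
    R [OF reducible_X2X4X4] R [OF reducible_X2X3X4] R [OF reducible_X2X3]
    R [OF reducible_X2X4] R [OF reducible_X2]
  have *: "i < bound J" if "k + J + 1 = c" "J < l" for J
    using R [OF reducible_X1X3 [OF that]] by simp
  have "m < 3" using r(4) by simp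
  then consider "m = 0" | "m = 1" | "m = 2" by linarith
  then show ?thesis
  proof cases
    case 1
    then show ?thesis using r(3,7,9) * by (cases "k = 0") auto
  next
    case 2
    then show ?thesis using r(2,3,6,8) by (cases "k = 0") auto
  next
    case 3
    then show ?thesis using r(1,2,5) by auto
  qed
qed

lemma ex_standard_max_degree:
  assumes "val i j k m = x"
  obtains u where "standard u" "value4 u = x" "\<And>i j k m. val i j k m = x \<Longrightarrow> i + j + k + m \<le> degree4 u"
proof -
  define P where "P = (\<lambda>u. value4 u = x)"
  have "P (i, j, k, m)" by (simp add: P_def assms)
  moreover have "\<forall>u. P u \<longrightarrow> degree4 u < Suc x"
    using degree_le_val by (auto simp: P_def less_Suc_eq_le)
  ultimately obtain v where v: "P v" "\<And>u. P u \<Longrightarrow> degree4 u \<le> degree4 v"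
    using ex_has_greatest_nat [of P _ degree4 "Suc x"] by blast
  \<comment> \<open>Among the factorizations of maximal length, one with the least exponent of
    \<open>X1\<close> is taken. Both ways of being reducible are thereby excluded, so it is
    standard.\<close>
  define Q where "Q = (\<lambda>u. P u \<and> degree4 u = degree4 v)"
  have "Q v" using v by (simp add: Q_def)
  then obtain w where w: "Q w" "\<And>u. Q u \<Longrightarrow> fst w \<le> fst u"
    using ex_has_least_nat [of Q v fst] by blast
  obtain i0 j0 k0 m0 where w0: "w = (i0, j0, k0, m0)" by (cases w)
  have "\<not> reducible i0 j0 k0 m0"
  proof
    assume "reducible i0 j0 k0 m0"
    then obtain i1 j1 k1 m1 where 1: "val i1 j1 k1 m1 = val i0 j0 k0 m0"
      "i0 + j0 + k0 + m0 < i1 + j1 + k1 + m1 \<or> i0 + j0 + k0 + m0 = i1 + j1 + k1 + m1 \<and> i1 < i0"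
      unfolding reducible_def by blast
    have "P (i1, j1, k1, m1)" using 1(1) w(1) by (simp add: Q_def P_def w0)
    then show False using v(2) [of "(i1, j1, k1, m1)"] w(2) [of "(i1, j1, k1, m1)"] 1(2) w(1)
      by (auto simp: Q_def w0)
  qed
  then have "standard w" unfolding w0 by (rule standard_if_irreducible)
  moreover have "value4 w = x" using w(1) by (simp add: Q_def P_def)
  moreover have "i + j + k + m \<le> degree4 w" if "val i j k m = x" for i j k m
    using v(2) [of "(i, j, k, m)"] w(1) that by (simp add: Q_def P_def)
  ultimately show ?thesis by (rule that)
qed

text \<open>Each semigroup element has exactly one standard factorization, and by
  \<open>ex_standard_max_degree\<close> it is one of maximal length.\<close>

lemma card_order_eq: "card (order_ge n - order_ge (Suc n)) = card {u. standard u \<and> degree4 u = n}"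
proof -
  have "value4 ` {u. standard u \<and> degree4 u = n} = order_ge n - order_ge (Suc n)"
  proof (intro equalityI subsetI)
    fix x assume "x \<in> value4 ` {u. standard u \<and> degree4 u = n}"
    then obtain i j k m where u: "standard (i, j, k, m)" "i + j + k + m = n" "x = val i j k m"
      by auto
    obtain v where v: "standard v" "value4 v = x" "\<And>i j k m. val i j k m = x \<Longrightarrow> i + j + k + m \<le> degree4 v"
      using ex_standard_max_degree u(3) by blast
    then have "v = (i, j, k, m)" using inj_onD [OF standard_inj, of v "(i, j, k, m)"] u by simp
    then have "x \<notin> order_ge (Suc n)" using v(3) u(2) by (auto simp: order_ge_def) fastforce
    moreover have "x \<in> order_ge n" using u by (intro order_geI) auto
    ultimately show "x \<in> order_ge n - order_ge (Suc n)" by blast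
  next
    fix x assume x: "x \<in> order_ge n - order_ge (Suc n)"
    then obtain i j k m where 1: "val i j k m = x" "n \<le> i + j + k + m" by (auto simp: order_ge_def)
    then obtain v where v: "standard v" "value4 v = x" "\<And>i j k m. val i j k m = x \<Longrightarrow> i + j + k + m \<le> degree4 v"
      using ex_standard_max_degree by blast
    obtain i' j' k' m' where v': "v = (i', j', k', m')" by (cases v)
    have "n \<le> degree4 v" using 1 v(3) by fastforce
    moreover have "\<not> Suc n \<le> degree4 v"
      using x v(2) order_geI [of "Suc n" i' j' k' m' x] by (auto simp: v')
    ultimately show "x \<in> value4 ` {u. standard u \<and> degree4 u = n}" using v by (intro image_eqI [of _ _ v]) auto
  qed
  then show ?thesis
    using card_image [OF inj_on_subset [OF standard_inj], of "{u. standard u \<and> degree4 u = n}"] by auto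
qed

end

section \<open>Generating functions\<close>

definition gen_fun :: "('a \<Rightarrow> nat) \<Rightarrow> 'a set \<Rightarrow> rat fps" where
  "gen_fun f A = Abs_fps (\<lambda>n. of_nat (card {x\<in>A. f x = n}))"

text \<open>The cardinality of an infinite set is 0, so \<open>gen_fun\<close> respects unions and
  products only under such a finiteness condition.\<close>

definition finite_fibers :: "('a \<Rightarrow> nat) \<Rightarrow> 'a set \<Rightarrow> bool" where
  "finite_fibers f A \<longleftrightarrow> (\<forall>n. finite {x\<in>A. f x = n})"

lemma finite_fibers_subset: "finite_fibers f B \<Longrightarrow> A \<subseteq> B \<Longrightarrow> finite_fibers f A"
  unfolding finite_fibers_def by (auto intro: finite_subset [of "{x \<in> A. f x = n}" "{x \<in> B. f x = n}" for n])

lemma finite_fibers_id: "finite_fibers (\<lambda>x. x) (A :: nat set)"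
  by (simp add: finite_fibers_def)

lemma gen_fun_Un:
  assumes "finite_fibers f A" "finite_fibers f B" "A \<inter> B = {}"
  shows "gen_fun f (A \<union> B) = gen_fun f A + gen_fun f B"
proof (rule fps_ext)
  fix n
  have "{x\<in>A \<union> B. f x = n} = {x\<in>A. f x = n} \<union> {x\<in>B. f x = n}" by blast
  moreover have "card ({x\<in>A. f x = n} \<union> {x\<in>B. f x = n}) = card {x\<in>A. f x = n} + card {x\<in>B. f x = n}"
    using assms by (intro card_Un_disjoint) (auto simp: finite_fibers_def)
  ultimately show "fps_nth (gen_fun f (A \<union> B)) n = fps_nth (gen_fun f A + gen_fun f B) n"
    by (simp add: gen_fun_def)
qed

lemma fiber_Times:
  "{p \<in> A \<times> B. (case p of (x, y) \<Rightarrow> f x + g y) = (n::nat)}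
    = (\<Union>i\<in>{0..n}. {x\<in>A. f x = i} \<times> {y\<in>B. g y = n - i})"
  by auto

lemma finite_fibers_Times:
  assumes "finite_fibers f A" "finite_fibers g B"
  shows "finite_fibers (\<lambda>(x, y). f x + g y) (A \<times> B)"
  using assms unfolding finite_fibers_def fiber_Times by blast

lemma gen_fun_Times:
  assumes "finite_fibers f A" "finite_fibers g B"
  shows "gen_fun (\<lambda>(x, y). f x + g y) (A \<times> B) = gen_fun f A * gen_fun g B"
proof (rule fps_ext)
  fix n
  have "card (\<Union>i\<in>{0..n}. {x\<in>A. f x = i} \<times> {y\<in>B. g y = n - i})
      = (\<Sum>i\<in>{0..n}. card ({x\<in>A. f x = i} \<times> {y\<in>B. g y = n - i}))"
    using assms by (intro card_UN_disjoint) (auto simp: finite_fibers_def)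
  then show "fps_nth (gen_fun (\<lambda>(x, y). f x + g y) (A \<times> B)) n = fps_nth (gen_fun f A * gen_fun g B) n"
    by (simp add: gen_fun_def fps_mult_nth fiber_Times card_cartesian_product)
qed

lemma gen_fun_singleton: "gen_fun (\<lambda>x. x) {k} = fps_X ^ k"
proof (rule fps_ext)
  fix n
  have "{x\<in>{k}. x = n} = (if n = k then {k} else {})" by auto
  then show "fps_nth (gen_fun (\<lambda>x. x) {k}) n = fps_nth (fps_X ^ k) n"
    by (simp add: gen_fun_def fps_X_power_nth)
qed

lemma gen_fun_UNIV: "(1 - fps_X) * gen_fun (\<lambda>x. x) UNIV = 1"
proof -
  have "gen_fun (\<lambda>x. x) UNIV = Abs_fps (\<lambda>n. 1)" by (simp add: gen_fun_def)
  then show ?thesis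
    by (simp add: fps_eq_iff left_diff_distrib fps_X_mult_nth)
qed

lemma gen_fun_lessThan: "(1 - fps_X) * gen_fun (\<lambda>x. x) {..<n} = 1 - fps_X ^ n"
proof (induction n)
  case 0
  have "gen_fun (\<lambda>x. x) {..<0} = 0" by (simp add: gen_fun_def fps_eq_iff)
  then show ?case by simp
next
  case (Suc n)
  have "gen_fun (\<lambda>x. x) {..<Suc n} = gen_fun (\<lambda>x. x) {..<n} + fps_X ^ n"
    using gen_fun_Un [of "\<lambda>x. x" "{..<n}" "{n}"]
    by (simp add: finite_fibers_id gen_fun_singleton lessThan_Suc)
  then have "(1 - fps_X) * gen_fun (\<lambda>x. x) {..<Suc n} = (1 - fps_X ^ n) + (1 - fps_X) * fps_X ^ n"
    by (simp only: distrib_left Suc)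
  then show ?case by (simp add: left_diff_distrib)
qed

section \<open>Summing over the boxes of normal forms\<close>

context pseudo_symmetric_generators
begin

text \<open>Nested so that \<open>gen_fun_Times\<close> applies to one coordinate at a time.\<close>

lemma degree4_eq:
  "degree4 = (\<lambda>(i, r). i + (case r of (j, r') \<Rightarrow> j + (case r' of (k, m) \<Rightarrow> k + m)))"
  by (auto simp: fun_eq_iff)

lemma finite_fibers_degree4: "finite_fibers degree4 A"
proof (rule finite_fibers_subset)
  show "finite_fibers degree4 (UNIV \<times> UNIV \<times> UNIV \<times> UNIV)"
    unfolding degree4_eq by (intro finite_fibers_Times finite_fibers_id)
qed simp

lemma gen_fun_box:
  "gen_fun degree4 (A \<times> B \<times> C \<times> D) = gen_fun (\<lambda>x. x) A * gen_fun (\<lambda>x. x) B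
     * gen_fun (\<lambda>x. x) C * gen_fun (\<lambda>x. x) D"
  unfolding degree4_eq
  by (simp add: gen_fun_Times finite_fibers_Times finite_fibers_id mult.assoc)

lemma hilbert_series_eq_gen_fun:
  "hilbert_series RS (series_ge 1 :: 'k::field fps set) = gen_fun degree4 (Collect standard)"
  by (simp add: hilbert_series_def hilbert_function_eq card_order_eq gen_fun_def del: One_nat_def)

definition bounded_X1 :: "nat \<Rightarrow> nat set" where
  "bounded_X1 J = (if J < l then {..<bound J} else UNIV)"

lemma Collect_standard_eq: "Collect standard =
    {..<d} \<times> {0} \<times> {0} \<times> {2}
  \<union> {..<d} \<times> {..<(2 * s + 1) * b + 1} \<times> {0} \<times> {1}
  \<union> {..<d} \<times> {..<b} \<times> {1..<c} \<times> {1}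
  \<union> UNIV \<times> {..<(2 * l + 2) * b + 1} \<times> {0} \<times> {0}
  \<union> (\<Union>J<c - 1. bounded_X1 J \<times> {..<2 * b} \<times> {c - 1 - J} \<times> {0})" (is "_ = ?T")
proof (rule Set.set_eqI)
  fix u :: "nat \<times> nat \<times> nat \<times> nat"
  obtain i j k m where u: "u = (i, j, k, m)" by (cases u)
  \<comment> \<open>The exponent \<open>k\<close> determines \<open>J = c - 1 - k\<close>, so the
    quantified condition concerns at most one \<open>J\<close>.\<close>
  have "k < c \<and> k \<ge> 1 \<and> (\<forall>J<l. k + J + 1 = c \<longrightarrow> i < bound J)
      \<longleftrightarrow> (\<exists>J<c - 1. k = c - 1 - J \<and> i \<in> bounded_X1 J)" (is "?L \<longleftrightarrow> ?R")
  proof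
    assume ?L
    then show ?R by (intro exI [of _ "c - 1 - k"]) (auto simp: bounded_X1_def)
  next
    assume ?R
    then obtain J where J: "J < c - 1" "k = c - 1 - J" "i \<in> bounded_X1 J" by blast
    have "i < bound J'" if "J' < l" "k + J' + 1 = c" for J'
    proof -
      have "J' = J" using J that by simp
      then show ?thesis using J that by (simp add: bounded_X1_def)
    qed
    then show ?L using J by auto
  qed
  moreover have "(i, j, k, m) \<in> (\<Union>J<c - 1. bounded_X1 J \<times> {..<2 * b} \<times> {c - 1 - J} \<times> {0})
      \<longleftrightarrow> m = 0 \<and> j < 2 * b \<and> ?R" by auto
  ultimately have union: "(i, j, k, m) \<in> (\<Union>J<c - 1. bounded_X1 J \<times> {..<2 * b} \<times> {c - 1 - J} \<times> {0})
      \<longleftrightarrow> m = 0 \<and> j < 2 * b \<and> ?L" by (simp only:)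
  show "u \<in> Collect standard \<longleftrightarrow> u \<in> ?T"
    unfolding u by (simp only: mem_Collect_eq standard.simps Un_iff union mem_Sigma_iff singleton_iff
        lessThan_iff atLeastLessThan_iff UNIV_I less_Suc_eq_le Suc_eq_plus1 [symmetric]) blast
qed

lemma gen_fun_standard: "gen_fun degree4 (Collect standard) =
    gen_fun (\<lambda>x. x) {..<d} * fps_X\<^sup>2
  + gen_fun (\<lambda>x. x) {..<d} * gen_fun (\<lambda>x. x) {..<(2 * s + 1) * b + 1} * fps_X
  + gen_fun (\<lambda>x. x) {..<d} * gen_fun (\<lambda>x. x) {..<b} * gen_fun (\<lambda>x. x) {1..<c} * fps_X
  + gen_fun (\<lambda>x. x) UNIV * gen_fun (\<lambda>x. x) {..<(2 * l + 2) * b + 1}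
  + gen_fun (\<lambda>x. x) {..<2 * b} * (\<Sum>J<c - 1. gen_fun (\<lambda>x. x) (bounded_X1 J) * fps_X ^ (c - 1 - J))"
proof -
  let ?F = "\<lambda>J. bounded_X1 J \<times> {..<2 * b} \<times> {c - 1 - J} \<times> {0::nat}"
  have "gen_fun degree4 (\<Union>J<n. ?F J) = (\<Sum>J<n. gen_fun degree4 (?F J))" if "n \<le> c - 1" for n
    using that
  proof (induction n)
    case (Suc n)
    have "(\<Union>J<Suc n. ?F J) = (\<Union>J<n. ?F J) \<union> ?F n" by (auto simp: lessThan_Suc)
    moreover have "(\<Union>J<n. ?F J) \<inter> ?F n = {}" using Suc.prems by auto
    ultimately show ?case using Suc by (simp add: gen_fun_Un finite_fibers_degree4)
  qed (simp add: gen_fun_def fps_eq_iff)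
  then have last: "gen_fun degree4 (\<Union>J<c - 1. ?F J)
      = gen_fun (\<lambda>x. x) {..<2 * b} * (\<Sum>J<c - 1. gen_fun (\<lambda>x. x) (bounded_X1 J) * fps_X ^ (c - 1 - J))"
    by (simp only: gen_fun_box gen_fun_singleton sum_distrib_left mult_ac power_0 mult_1_left order_refl)
  have disjoint: "gen_fun degree4 (A1 \<union> A2 \<union> A3 \<union> A4 \<union> A5) = gen_fun degree4 A1 + gen_fun degree4 A2
      + gen_fun degree4 A3 + gen_fun degree4 A4 + gen_fun degree4 A5"
    if "A1 \<inter> A2 = {}" "(A1 \<union> A2) \<inter> A3 = {}" "(A1 \<union> A2 \<union> A3) \<inter> A4 = {}"
      "(A1 \<union> A2 \<union> A3 \<union> A4) \<inter> A5 = {}" for A1 A2 A3 A4 A5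
    using that by (simp only: gen_fun_Un finite_fibers_degree4)
  show ?thesis
    unfolding Collect_standard_eq
    by (rule trans [OF disjoint];
        (simp only: last gen_fun_box gen_fun_singleton power_0 power_one_right mult_1_right; fail | auto))
qed

lemma gen_fun_atLeast1: "(1 - fps_X) * gen_fun (\<lambda>x. x) {1..<c} = fps_X - fps_X ^ c"
proof -
  have "{..<c} = {0} \<union> {1..<c}" using param_pos by auto
  then have "gen_fun (\<lambda>x. x) {..<c} = 1 + gen_fun (\<lambda>x. x) {1..<c}"
    using gen_fun_Un [of "\<lambda>x. x" "{0}" "{1..<c}"]
    by (simp add: finite_fibers_id gen_fun_singleton)
  then show ?thesis using gen_fun_lessThan [of c] by (simp add: algebra_simps)
qed

text \<open>The origin of \<open>R(t)\<close>: it collects the degrees of the corner monomials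
  \<open>X1^(bound J) X3^(c-1-J)\<close>. They grow by \<open>a + 2d - 1\<close> with
  \<open>J\<close>, with an additional \<open>d\<close> from \<open>J = s\<close> on.\<close>

lemma R_term_eq:
  "(\<Sum>J<l. fps_X ^ (c - 1 - J + bound J)) = fps_of_poly (R_term a c d s l [:0, 1:])"
proof -
  have split: "{..<l} = {..<s} \<union> {s..<s + (l - s)}" using s_le by auto
  have 1: "c - 1 - J + bound J = 2 * d + c + J * (a + 2 * d - 1)" if "J < s" for J
  proof -
    \<comment> \<open>Writing \<open>c = J + 1 + r\<close> and \<open>a = p + 1\<close> removes all
      truncated subtractions.\<close>
    have "J + 1 \<le> c" using that s_le l_less by simp
    then obtain r where r: "c = J + 1 + r" using le_Suc_ex by blast
    obtain p where "a = p + 1" using param_pos by (cases a) auto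
    moreover have "bound J = J * a + (2 * J + 2) * d + 1" using that by (simp add: bound_def)
    ultimately show ?thesis using r by (simp add: algebra_simps)
  qed
  have 2: "c - 1 - (s + j) + bound (s + j) = s * a + (2 * s + 3) * d + c - s + j * (a + 2 * d - 1)"
    if "j < l - s" for j
  proof -
    have "s + j + 1 \<le> c" using that l_less by simp
    then obtain r where r: "c = s + j + 1 + r" using le_Suc_ex by blast
    obtain p where "a = p + 1" using param_pos by (cases a) auto
    moreover have "bound (s + j) = (s + j) * a + (2 * (s + j) + 3) * d + 1" by (simp add: bound_def)
    ultimately show ?thesis using r by (simp add: algebra_simps)
  qed
  have "(\<Sum>J<l. fps_X ^ (c - 1 - J + bound J)) = (\<Sum>J<s. fps_X ^ (c - 1 - J + bound J) :: rat fps)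
      + (\<Sum>J\<in>{s..<s + (l - s)}. fps_X ^ (c - 1 - J + bound J))"
    unfolding split by (rule sum.union_disjoint) auto
  also have "(\<Sum>J\<in>{s..<s + (l - s)}. fps_X ^ (c - 1 - J + bound J))
      = (\<Sum>j<l - s. fps_X ^ (c - 1 - (s + j) + bound (s + j)) :: rat fps)"
    using sum.shift_bounds_nat_ivl [of "\<lambda>J. fps_X ^ (c - 1 - J + bound J)" 0 s "l - s"]
    by (simp add: atLeast0LessThan add.commute)
  also have "(\<Sum>J<s. fps_X ^ (c - 1 - J + bound J) :: rat fps)
      = fps_X ^ (2 * d + c) * (\<Sum>j<s. fps_X ^ (j * (a + 2 * d - 1)))"
    unfolding sum_distrib_left power_add [symmetric] by (intro sum.cong refl arg_cong [of _ _ "(^) fps_X"] 1) simp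
  also have "(\<Sum>j<l - s. fps_X ^ (c - 1 - (s + j) + bound (s + j)) :: rat fps)
      = fps_X ^ (s * a + (2 * s + 3) * d + c - s) * (\<Sum>j<l - s. fps_X ^ (j * (a + 2 * d - 1)))"
    unfolding sum_distrib_left power_add [symmetric] by (intro sum.cong refl arg_cong [of _ _ "(^) fps_X"] 2) simp
  finally show ?thesis
    by (simp only: R_term_def fps_of_poly_add fps_of_poly_mult fps_of_poly_power fps_of_poly_sum
        fps_of_poly_fps_X)
qed

text \<open>One factor \<open>1 - X\<close> clears the range of \<open>X1\<close>, the other the
  geometric sum over the powers of \<open>X3\<close>. The rows \<open>J < l\<close> are cut off at
  \<open>bound J\<close>, which produces the \<open>R\<close> term.\<close>

lemma gen_fun_bounded_X1_sum:
  "(1 - fps_X)\<^sup>2 * (\<Sum>J<c - 1. gen_fun (\<lambda>x. x) (bounded_X1 J) * fps_X ^ (c - 1 - J))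
    = fps_X - fps_X ^ c - (1 - fps_X) * fps_of_poly (R_term a c d s l [:0, 1:])"
proof -
  let ?Y = "1 - fps_X :: rat fps"
  have geom: "?Y * (\<Sum>J<n. fps_X ^ (n - J)) = fps_X - fps_X ^ Suc n" for n
  proof (induction n)
    case (Suc n)
    have "?Y * (\<Sum>J<Suc n. fps_X ^ (Suc n - J)) = ?Y * fps_X ^ Suc n + ?Y * (\<Sum>J<n. fps_X ^ (n - J))"
      unfolding sum.lessThan_Suc_shift by (simp add: distrib_left)
    then show ?case unfolding Suc by (simp add: algebra_simps)
  qed simp
  have if_power: "(1 - (if P then fps_X ^ m else 0)) * fps_X ^ n
      = fps_X ^ n - (if P then fps_X ^ (n + m) else 0 :: rat fps)" for P m n
    by (simp add: left_diff_distrib power_add)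
  have "?Y * gen_fun (\<lambda>x. x) (bounded_X1 J) = 1 - (if J < l then fps_X ^ bound J else 0)" for J
    by (simp add: bounded_X1_def gen_fun_lessThan gen_fun_UNIV)
  then have "?Y * (\<Sum>J<c - 1. gen_fun (\<lambda>x. x) (bounded_X1 J) * fps_X ^ (c - 1 - J))
      = (\<Sum>J<c - 1. (1 - (if J < l then fps_X ^ bound J else 0)) * fps_X ^ (c - 1 - J))"
    by (simp add: sum_distrib_left flip: mult.assoc)
  also have "\<dots> = (\<Sum>J<c - 1. fps_X ^ (c - 1 - J) - (if J < l then fps_X ^ (c - 1 - J + bound J) else 0))"
    by (simp only: if_power)
  also have "\<dots> = (\<Sum>J<c - 1. fps_X ^ (c - 1 - J)) - (\<Sum>J<l. fps_X ^ (c - 1 - J + bound J))"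
  proof -
    have "{..<c - 1} \<inter> {J. J < l} = {..<l}" using l_less by auto
    then show ?thesis by (simp add: sum_subtractf sum.If_cases)
  qed
  finally have "?Y\<^sup>2 * (\<Sum>J<c - 1. gen_fun (\<lambda>x. x) (bounded_X1 J) * fps_X ^ (c - 1 - J))
      = ?Y * ((\<Sum>J<c - 1. fps_X ^ (c - 1 - J)) - fps_of_poly (R_term a c d s l [:0, 1:]))"
    by (simp only: power2_eq_square mult.assoc R_term_eq)
  also have "\<dots> = ?Y * (\<Sum>J<c - 1. fps_X ^ (c - 1 - J)) - ?Y * fps_of_poly (R_term a c d s l [:0, 1:])"
    by (rule right_diff_distrib)
  finally show ?thesis unfolding geom using param_pos by simp
qed

lemma gen_fun_standard_eq:
  "(1 - fps_X) ^ 4 * gen_fun degree4 (Collect standard) = fps_of_poly (let t = [:0, 1:] in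
     1 - 3 * t ^ 3 + 3 * t ^ 4 - t ^ 5
     - t ^ (d + 1) * (1 - t) * (1 + t - 2 * t ^ 2 + t ^ 3)
     - t ^ c * (1 - t ^ (d + 1) - t ^ 2 * (1 - t ^ d))
     - t ^ (b + 2) * (1 - t) * (1 - t ^ d) * (1 - t ^ (c - 1))
     - t ^ (2 * b + 1) * (1 - t) * (1 - t ^ (c - 1))
     - (1 - t) ^ 2 * (1 - t ^ (2 * b)) * R_term a c d s l t
     - (1 - t) ^ 2 * (1 - t ^ d) * t ^ ((2 * s + 1) * b + 2)
     - (1 - t) ^ 2 * t ^ ((2 * l + 2) * b + 1))" (is "_ = fps_of_poly ?P")
proof -
  define x :: "rat fps" where "x = fps_X"
  \<comment> \<open>Powers with symbolic exponents become independent atoms, which leaves a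
    polynomial identity in finitely many unknowns.\<close>
  define D B B2 C S L where "D = x ^ d" and "B = x ^ b" and "B2 = x ^ (2 * b)" and "C = x ^ (c - 1)"
    and "S = x ^ ((2 * s + 1) * b)" and "L = x ^ ((2 * l + 2) * b)"
  define R where "R = fps_of_poly (R_term a c d s l [:0, 1:])"
  define v where "v = gen_fun (\<lambda>x. x) UNIV"
  define uD uB uB2 uS uL w Z where "uD = gen_fun (\<lambda>x. x) {..<d}" and "uB = gen_fun (\<lambda>x. x) {..<b}"
    and "uB2 = gen_fun (\<lambda>x. x) {..<2 * b}" and "uS = gen_fun (\<lambda>x. x) {..<(2 * s + 1) * b + 1}"
    and "uL = gen_fun (\<lambda>x. x) {..<(2 * l + 2) * b + 1}" and "w = gen_fun (\<lambda>x. x) {1..<c}"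
    and "Z = (\<Sum>J<c - 1. gen_fun (\<lambda>x. x) (bounded_X1 J) * fps_X ^ (c - 1 - J))"
  define y where "y = 1 - x"
  have xc: "x ^ c = x * C" using param_pos by (cases c) (auto simp: C_def)
  have v: "(1 - x) * v = 1" unfolding x_def v_def by (rule gen_fun_UNIV)
  have u: "(1 - x) * uD = 1 - D" "(1 - x) * uB = 1 - B" "(1 - x) * uB2 = 1 - B2"
    "(1 - x) * uS = 1 - x * S" "(1 - x) * uL = 1 - x * L"
    unfolding uD_def uB_def uB2_def uS_def uL_def x_def D_def B_def B2_def S_def L_def gen_fun_lessThan
    by simp_all
  have w: "(1 - x) * w = x - x * C"
    unfolding w_def xc [symmetric] unfolding x_def by (rule gen_fun_atLeast1)
  have Z: "(1 - x)\<^sup>2 * Z = x - x * C - (1 - x) * R"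
    unfolding Z_def xc [symmetric] unfolding x_def R_def by (rule gen_fun_bounded_X1_sum)
  have "(1 - x) ^ 4 * gen_fun degree4 (Collect standard)
      = (1 - x) ^ 4 * (uD * x\<^sup>2 + uD * uS * x + uD * uB * w * x + v * uL + uB2 * Z)"
    unfolding gen_fun_standard uD_def uS_def uB_def w_def v_def uL_def uB2_def Z_def x_def ..
  \<comment> \<open>The four factors \<open>1 - x\<close> are distributed so that each generating
    function receives what its closed form needs, \<open>Z\<close> two of them.\<close>
  also have "\<dots> = x\<^sup>2 * (1 - x) ^ 3 * ((1 - x) * uD) + x * (1 - x)\<^sup>2 * ((1 - x) * uD) * ((1 - x) * uS)
      + x * (1 - x) * ((1 - x) * uD) * ((1 - x) * uB) * ((1 - x) * w)
      + (1 - x)\<^sup>2 * ((1 - x) * v) * ((1 - x) * uL) + (1 - x) * ((1 - x) * uB2) * ((1 - x)\<^sup>2 * Z)"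
    unfolding y_def [symmetric]
    by (simp add: algebra_simps power2_eq_square power3_eq_cube power4_eq_xxxx)
  also have "\<dots> = 1 - 3 * x ^ 3 + 3 * x ^ 4 - x ^ 5 - D * x * (1 - x) * (1 + x - 2 * x ^ 2 + x ^ 3)
      - x * C * (1 - D * x - x ^ 2 * (1 - D)) - B * x\<^sup>2 * (1 - x) * (1 - D) * (1 - C)
      - B2 * x * (1 - x) * (1 - C) - (1 - x) ^ 2 * (1 - B2) * R
      - (1 - x) ^ 2 * (1 - D) * (S * x\<^sup>2) - (1 - x) ^ 2 * (L * x)"
    unfolding u v w Z by (simp add: algebra_simps eval_nat_numeral)
  also have "\<dots> = fps_of_poly ?P"
    unfolding xc [symmetric] Let_def
    by (simp only: fps_of_poly_add fps_of_poly_diff fps_of_poly_mult fps_of_poly_power fps_of_poly_1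
        fps_of_poly_numeral fps_of_poly_fps_X R_def [symmetric] x_def [symmetric])
       (simp add: D_def B_def B2_def C_def S_def L_def power_add mult_ac power2_eq_square)
  finally show ?thesis unfolding x_def .
qed

end

theorem theorem4p1:
  fixes n1 n2 n3 n4 \<alpha>1 \<alpha>2 \<alpha>3 \<alpha>4 \<alpha>21 s l :: nat
    and RS :: "'k::alg_closed_field fps ring" and \<mm> :: "'k fps set"
  assumes RS: "RS = semigroup_ring n1 n2 n3 n4"
    and m: "\<mm> = semigroup_ring_max n1 n2 n3 n4"
    and gcd: "Gcd {n1, n2, n3, n4} = 1"
    and pseudo_symmetric: "pseudo_symmetric (semigroup4 n1 n2 n3 n4)"
    and parameters: "ps_parameters n1 n2 n3 n4 \<alpha>1 \<alpha>2 \<alpha>3 \<alpha>4 \<alpha>21"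
    and "\<alpha>4 = 3"
    and "n1 < n2" and "n2 < n3" and "n3 < n4"
    and "\<alpha>2 > \<alpha>21 + 1"
    and s: "is_arg_min (\<lambda>k. k)
          (\<lambda>k. k * \<alpha>1 + (2 * k + 2) * \<alpha>21 + \<alpha>3 > (2 * k + 1) * \<alpha>2 + (k + 2)) s"
    and l: "is_arg_min (\<lambda>k. k)
          (\<lambda>k. k * \<alpha>1 + (2 * k + 3) * \<alpha>21 + \<alpha>3 > (2 * k + 2) * \<alpha>2 + (k + 1)) l"
  shows "hilbert_series RS \<mm> =
    (let t = [:0, 1:];
         P = 1 - 3 * t ^ 3 + 3 * t ^ 4 - t ^ 5
             - t ^ (\<alpha>21 + 1) * (1 - t) * (1 + t - 2 * t ^ 2 + t ^ 3)
             - t ^ \<alpha>3 * (1 - t ^ (\<alpha>21 + 1) - t ^ 2 * (1 - t ^ \<alpha>21))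
             - t ^ (\<alpha>2 + 2) * (1 - t) * (1 - t ^ \<alpha>21) * (1 - t ^ (\<alpha>3 - 1))
             - t ^ (2 * \<alpha>2 + 1) * (1 - t) * (1 - t ^ (\<alpha>3 - 1))
             - (1 - t) ^ 2 * (1 - t ^ (2 * \<alpha>2)) * R_term \<alpha>1 \<alpha>3 \<alpha>21 s l t
             - (1 - t) ^ 2 * (1 - t ^ \<alpha>21) * t ^ ((2 * s + 1) * \<alpha>2 + 2)
             - (1 - t) ^ 2 * t ^ ((2 * l + 2) * \<alpha>2 + 1)
     in fps_of_poly P / (1 - fps_X) ^ 4)"
proof -
  let ?c = "\<alpha>3" and ?a = "\<alpha>1" and ?b = "\<alpha>2" and ?d = "\<alpha>21"
  have pos: "1 \<le> ?d" "?d + 1 < ?b" "2 \<le> ?c" "?d + 1 < ?a"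
    and n1: "int n1 = 2 * int ?b * int ?c + 1"
    and n2: "int n2 = (int ?c - 1) * (int ?a + 2 * int ?d) + 3 * int ?d + 1"
    using parameters \<open>\<alpha>4 = 3\<close> \<open>\<alpha>2 > \<alpha>21 + 1\<close> by (auto simp: ps_parameters_def algebra_simps)
  have n3: "int n3 = (int ?a + 2 * int ?d) * int n1 - 2 * int ?b * int n2"
    and n4: "int n4 = int ?b * int n2 - int ?d * int n1"
    unfolding n1 n2
    using parameters \<open>\<alpha>4 = 3\<close> by (auto simp: ps_parameters_def algebra_simps)
  have "coprime n1 n2"
  proof (rule coprimeI)
    fix g assume g: "g dvd n1" "g dvd n2"
    \<comment> \<open>\<open>n3\<close> and \<open>n4\<close> are integer combinations of
      \<open>n1\<close> and \<open>n2\<close>, so a common divisor of the latter divides all four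
      generators.\<close>
    then have "int g dvd int n3" "int g dvd int n4" unfolding n3 n4 by simp_all
    then have "g dvd Gcd {n1, n2, n3, n4}" using g by (intro Gcd_greatest) auto
    then show "is_unit g" by (simp only: gcd)
  qed
  moreover have s_sat: "(2 * s + 1) * ?b + (s + 2) < s * ?a + (2 * s + 2) * ?d + ?c"
    and s_min: "\<And>J. J < s \<Longrightarrow> J * ?a + (2 * J + 2) * ?d + ?c \<le> (2 * J + 1) * ?b + (J + 2)"
    using s unfolding is_arg_min_def by (simp, meson not_le)
  moreover have l_sat: "(2 * l + 2) * ?b + (l + 1) < l * ?a + (2 * l + 3) * ?d + ?c"
    and l_min: "\<And>J. J < l \<Longrightarrow> J * ?a + (2 * J + 3) * ?d + ?c \<le> (2 * J + 2) * ?b + (J + 1)"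
    using l unfolding is_arg_min_def by (simp, meson not_le)
  moreover have "s \<le> l"
  proof (rule ccontr)
    assume "\<not> s \<le> l"
    \<comment> \<open>If \<open>l < s\<close>, the inequality for \<open>s\<close> fails at
      \<open>l\<close>; subtracting this from the inequality for \<open>l\<close> gives
      \<open>b < d + 1\<close>.\<close>
    then show False using s_min [of l] l_sat pos(2) by (simp add: algebra_simps)
  qed
  moreover have "l < ?c"
  proof (rule ccontr)
    assume "\<not> l < ?c"
    moreover obtain e where e: "?c = Suc e" using pos(3) by (cases ?c) auto
    \<comment> \<open>If \<open>c \<le> l\<close>, minimality of \<open>l\<close> applies at
      \<open>c - 1\<close>, where the failed inequality amounts to
      \<open>n2 \<le> n1\<close>.\<close>
    ultimately have "e * ?a + (2 * e + 3) * ?d + ?c \<le> (2 * e + 2) * ?b + (e + 1)"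
      by (intro l_min) simp
    then have "int (e * ?a + (2 * e + 3) * ?d + ?c) \<le> int ((2 * e + 2) * ?b + (e + 1))"
      by (simp only: of_nat_le_iff)
    then have "int n2 \<le> int n1"
      unfolding n1 n2 by (simp add: e algebra_simps)
    then show False using \<open>n1 < n2\<close> by simp
  qed
  moreover have "0 < n1"
  proof -
    have "0 < int n1" unfolding n1 by (intro add_nonneg_pos) simp_all
    then show ?thesis by (simp only: of_nat_0_less_iff)
  qed
  ultimately interpret pseudo_symmetric_generators n1 n2 n3 n4 ?a ?b ?c ?d s l
    using pos n1 n2 n3 n4 \<open>n1 < n2\<close> \<open>n2 < n3\<close> \<open>n3 < n4\<close> by unfold_locales simp_all
  have "fps_nth (1 - fps_X :: rat fps) 0 \<noteq> 0" by simp
  then have "(1 - fps_X :: rat fps) ^ 4 \<noteq> 0" by fastforce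
  then have "gen_fun degree4 (Collect standard) = (1 - fps_X) ^ 4 * gen_fun degree4 (Collect standard) / (1 - fps_X) ^ 4"
    by (rule nonzero_mult_div_cancel_left [symmetric])
  then show ?thesis
    unfolding RS m semigroup_ring_max_eq hilbert_series_eq_gen_fun gen_fun_standard_eq Let_def .
qed


end
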